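(* The group $\mathbb{Z}\wr\mathbb{Z}$ (with its canonical word metric) has edge Markov type $p$ for every $1\le p<\frac43$, but it does not have Enflo type $p$ for any $p>1$.
   Context: The wreath product $\mathbb{Z}\wr\mathbb{Z}$ is the group of all pairs $(f,x)$ with $f:\mathbb{Z}\to\mathbb{Z}$ finitely supported and $x\in\mathbb{Z}$, with product $(f,x)(g,y)=(z\mapsto f(z)+g(z-x),\,x+y)$. It is generated by $(0,\pm1)$ and $(\pm\delta_0,0)$, where $\delta_0$ is the indicator of $0$; it is viewed as the corresponding Cayley graph with its shortest path (word) metric. A Markov chain $\{Z_t\}_{t=0}^\infty$ with transition probabilities $a_{ij}=\Pr(Z_{t+1}=j\mid Z_t=i)$ on $\{1,\dots,n\}$ is stationary if $\pi_i=\Pr(Z_t=i)$ does not depend on $t$, and reversible if $\pi_i a_{ij}=\pi_j a_{ji}$ for all $i,j$. Let $p\in[1,\infty)$. An unweighted graph $X$ with shortest path metric $d_X$ has edge Markov type $p$ if there is a constant $K>0$ such that for every $n$, every stationary reversible Markov chain $\{Z_t\}_{t=0}^\infty$ on $\{1,\dots,n\}$, every map $f:\{1,\dots,n\}\to X$ for which $f(Z_0)f(Z_1)$ is an edge of $X$ (pointwise), and every $t\in\mathbb{N}$, $$\mathbb{E}\big[d_X(f(Z_t),f(Z_0))^p\big]\le K^p\,t\,\mathbb{E}\big[d_X(f(Z_1),f(Z_0))^p\big].$$ A metric space $(X,d_X)$ has Enflo type $p$ if there is a constant $K$ such that for every $n\in\mathbb{N}$ and every $f:\{-1,1\}^n\to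 X$, $$\mathbb{E}\big[d_X(f(\varepsilon),f(-\varepsilon))^p\big]\le K^p\sum_{j=1}^n\mathbb{E}\big[d_X\big(f(\varepsilon_1,\dots,\varepsilon_j,\dots,\varepsilon_n),f(\varepsilon_1,\dots,\varepsilon_{j-1},-\varepsilon_j,\varepsilon_{j+1},\dots,\varepsilon_n)\big)^p\big],$$ where the expectation is with respect to the uniform measure on $\{-1,1\}^n$. *)

theory Defs
  imports "HOL-Probability.Probability" "HOL-Algebra.Group"
begin

section \<open>The wreath product of the integers with the integers\<close>

definition wreath_ZZ :: "((int \<Rightarrow> int) \<times> int) monoid" where
  "wreath_ZZ =
    \<lparr> carrier = {(f, x). finite {z. f z \<noteq> 0}},
      mult = (\<lambda>(f, x) (g, y). (\<lambda>z. f z + g (z - x), x + y)),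
      one = (\<lambda>z. 0, 0) \<rparr>"

definition delta0 :: "int \<Rightarrow> int" where
  "delta0 z = (if z = 0 then 1 else 0)"

definition wreath_ZZ_gens :: "((int \<Rightarrow> int) \<times> int) set" where
  "wreath_ZZ_gens =
    {(\<lambda>z. 0, 1), (\<lambda>z. 0, - 1), (delta0, 0), (\<lambda>z. - delta0 z, 0)}"

lemma group_wreath_ZZ: "group wreath_ZZ"
proof (rule groupI)
  fix a b assume "a \<in> carrier wreath_ZZ" "b \<in> carrier wreath_ZZ"
  then obtain f x g y where ab: "a = (f, x)" "b = (g, y)"
    and fin: "finite {z. f z \<noteq> 0}" "finite {z. g z \<noteq> 0}"
    by (auto simp: wreath_ZZ_def)
  have "{z. f z + g (z - x) \<noteq> 0} \<subseteq> {z. f z \<noteq> 0} \<union> (\<lambda>z. z + x) ` {z. g z \<noteq> 0}"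
  proof
    fix z assume z: "z \<in> {z. f z + g (z - x) \<noteq> 0}"
    show "z \<in> {z. f z \<noteq> 0} \<union> (\<lambda>z. z + x) ` {z. g z \<noteq> 0}"
      using z by (cases "f z = 0") (auto intro!: image_eqI[of _ _ "z - x"])
  qed
  then have "finite {z. f z + g (z - x) \<noteq> 0}"
    using fin by (meson finite_UnI finite_imageI finite_subset)
  then show "a \<otimes>\<^bsub>wreath_ZZ\<^esub> b \<in> carrier wreath_ZZ"
    by (simp add: ab wreath_ZZ_def)
next
  fix a assume "a \<in> carrier wreath_ZZ"
  then obtain f x where a: "a = (f, x)" and fin: "finite {z. f z \<noteq> 0}"
    by (auto simp: wreath_ZZ_def)
  have "{z. - f (z + x) \<noteq> 0} \<subseteq> (\<lambda>z. z - x) ` {z. f z \<noteq> 0}"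
    by (auto intro!: image_eqI[of _ _ "_ + x"])
  then have "finite {z. - f (z + x) \<noteq> 0}"
    using fin by (meson finite_imageI finite_subset)
  then show "\<exists>b\<in>carrier wreath_ZZ. b \<otimes>\<^bsub>wreath_ZZ\<^esub> a = \<one>\<^bsub>wreath_ZZ\<^esub>"
    by (intro bexI[of _ "(\<lambda>z. - f (z + x), - x)"]) (auto simp: a wreath_ZZ_def)
qed (auto simp: wreath_ZZ_def algebra_simps)

section \<open>Cayley graphs and shortest path metrics\<close>

text \<open>Edges join \<open>g\<close> to \<open>g s\<close> for a generator \<open>s\<close>, so left translations are automorphisms.\<close>

definition cayley_adj :: "('a, 'b) monoid_scheme \<Rightarrow> 'a set \<Rightarrow> 'a \<Rightarrow> 'a \<Rightarrow> bool" where
  "cayley_adj G S g h \<longleftrightarrow> g \<in> carrier G \<and> (\<exists>s\<in>S. h = g \<otimes>\<^bsub>G\<^esub> s)"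

text \<open>The iterate \<open>(adj ^^ k) x y\<close> says that there is a walk with \<open>k\<close> edges from \<open>x\<close> to \<open>y\<close>.
  The distance is only meaningful between vertices in the same connected component;
  for the wreath product see \<open>wreath_ZZ_connected\<close> below.\<close>

definition path_dist :: "('a \<Rightarrow> 'a \<Rightarrow> bool) \<Rightarrow> 'a \<Rightarrow> 'a \<Rightarrow> real" where
  "path_dist adj x y = real (LEAST k. (adj ^^ k) x y)"

definition wreath_ZZ_adj :: "(int \<Rightarrow> int) \<times> int \<Rightarrow> (int \<Rightarrow> int) \<times> int \<Rightarrow> bool" where
  "wreath_ZZ_adj = cayley_adj wreath_ZZ wreath_ZZ_gens"

definition wreath_ZZ_dist :: "(int \<Rightarrow> int) \<times> int \<Rightarrow> (int \<Rightarrow> int) \<times> int \<Rightarrow> real" where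
  "wreath_ZZ_dist = path_dist wreath_ZZ_adj"

lemma wreath_ZZ_adj_steps:
  assumes "finite {z. f z \<noteq> 0}"
  shows "wreath_ZZ_adj (f, x) (f, x + 1)" "wreath_ZZ_adj (f, x) (f, x - 1)"
    "wreath_ZZ_adj (f, x) (f(x := f x + 1), x)" "wreath_ZZ_adj (f, x) (f(x := f x - 1), x)"
  using assms
  by (auto simp: wreath_ZZ_adj_def cayley_adj_def wreath_ZZ_gens_def wreath_ZZ_def delta0_def)

lemma wreath_ZZ_connected:
  assumes "u \<in> carrier wreath_ZZ" "v \<in> carrier wreath_ZZ"
  shows "\<exists>k. (wreath_ZZ_adj ^^ k) u v"
proof -
  let ?R = "wreath_ZZ_adj\<^sup>*\<^sup>*"
  have move: "?R (f, x) (f, y)" if "finite {z. f z \<noteq> 0}" for f x y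
    by (induction y rule: int_induct[of _ x])
      (auto intro: rtranclp.rtrancl_into_rtrancl wreath_ZZ_adj_steps[OF that])
  have fin: "finite {z. (f(x := c)) z \<noteq> (0::int)}" if "finite {z. f z \<noteq> 0}"
    for f and x c :: int
    by (rule finite_subset[of _ "insert x {z. f z \<noteq> 0}"]) (use that in auto)
  have switch: "?R (f, x) (f(x := c), x)" if "finite {z. f z \<noteq> 0}" for f x c
  proof (induction c rule: int_induct[of _ "f x"])
    case (step1 i)
    have "wreath_ZZ_adj (f(x := i), x) (f(x := i + 1), x)"
      using wreath_ZZ_adj_steps(3)[OF fin[OF that, of x i], of x]
      by (simp only: fun_upd_same fun_upd_upd)
    with step1.IH show ?case by (rule rtranclp.rtrancl_into_rtrancl)
  next
    case (step2 i)
    have "wreath_ZZ_adj (f(x := i), x) (f(x := i - 1), x)"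
      using wreath_ZZ_adj_steps(4)[OF fin[OF that, of x i], of x]
      by (simp only: fun_upd_same fun_upd_upd)
    with step2.IH show ?case by (rule rtranclp.rtrancl_into_rtrancl)
  qed simp
  have upd: "?R (f, x) (f(y := c), x)" if "finite {z. f z \<noteq> 0}" for f x y c
    using move[OF that, of x y] switch[OF that, of y c] move[OF fin[OF that], of y c y x]
    by (meson rtranclp_trans)
  obtain f x g y where uv: "u = (f, x)" "v = (g, y)"
    and f: "finite {z. f z \<noteq> 0}" and g: "finite {z. g z \<noteq> 0}"
    using assms by (auto simp: wreath_ZZ_def)
  have reach: "?R (f, x) (\<lambda>z. if z \<in> A then g z else f z, x)" if "finite A" for A
    using that
  proof (induction A rule: finite_induct)
    case (insert a A)
    let ?h = "\<lambda>z. if z \<in> A then g z else f z"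
    have "finite {z. ?h z \<noteq> 0}"
      by (rule finite_subset[OF _ finite_UnI[OF f g]]) auto
    from upd[OF this, of x a "g a"]
    have "?R (?h, x) (?h(a := g a), x)" .
    moreover have "?h(a := g a) = (\<lambda>z. if z \<in> insert a A then g z else f z)"
      by auto
    ultimately show ?case
      using insert.IH by (metis (no_types, lifting) rtranclp_trans)
  qed simp
  have "(\<lambda>z. if z \<in> {z. f z \<noteq> 0} \<union> {z. g z \<noteq> 0} then g z else f z) = g"
    by auto
  then have "?R (f, x) (g, x)"
    using reach[OF finite_UnI[OF f g]] by simp
  then show ?thesis
    using move[OF g, of x y] rtranclp_imp_relpowp uv by (metis (no_types, lifting) rtranclp_trans)
qed

section \<open>Edge Markov type\<close>

text \<open>Measurability of \<open>Z t\<close> into \<open>count_space {1..n}\<close> includes that its values lie in \<open>{1..n}\<close>.\<close>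

definition markov_chain ::
  "'w measure \<Rightarrow> nat \<Rightarrow> (nat \<Rightarrow> nat \<Rightarrow> real) \<Rightarrow> (nat \<Rightarrow> 'w \<Rightarrow> nat) \<Rightarrow> bool" where
  "markov_chain M n a Z \<longleftrightarrow>
     prob_space M \<and>
     (\<forall>t. Z t \<in> measurable M (count_space {1..n})) \<and>
     (\<forall>i\<in>{1..n}. (\<forall>j\<in>{1..n}. 0 \<le> a i j) \<and> (\<Sum>j=1..n. a i j) = 1) \<and>
     (\<forall>t i. \<forall>j\<in>{1..n}.
        \<P>(\<omega> in M. \<forall>s\<le>t. Z s \<omega> = i s) > 0 \<longrightarrow>
        \<P>(\<omega> in M. Z (Suc t) \<omega> = j \<bar> \<forall>s\<le>t. Z s \<omega> = i s) = a (i t) j)"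

definition stationary_chain :: "'w measure \<Rightarrow> nat \<Rightarrow> (nat \<Rightarrow> 'w \<Rightarrow> nat) \<Rightarrow> bool" where
  "stationary_chain M n Z \<longleftrightarrow>
     (\<forall>i\<in>{1..n}. \<forall>t. \<P>(\<omega> in M. Z t \<omega> = i) = \<P>(\<omega> in M. Z 0 \<omega> = i))"

definition reversible_chain ::
  "'w measure \<Rightarrow> nat \<Rightarrow> (nat \<Rightarrow> nat \<Rightarrow> real) \<Rightarrow> (nat \<Rightarrow> 'w \<Rightarrow> nat) \<Rightarrow> bool" where
  "reversible_chain M n a Z \<longleftrightarrow>
     (\<forall>i\<in>{1..n}. \<forall>j\<in>{1..n}.
        \<P>(\<omega> in M. Z 0 \<omega> = i) * a i j = \<P>(\<omega> in M. Z 0 \<omega> = j) * a j i)"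

text \<open>A formula cannot quantify over the type of the sample space. All probability spaces on
  \<^typ>\<open>nat \<Rightarrow> nat\<close> are admitted here, which is enough to realize the law of every chain; the
  lemma \<open>edge_markov_type_any_sample_space\<close> below gives the inequality, with the same
  constant, for chains on sample spaces of arbitrary type.\<close>

definition edge_markov_type_const ::
  "'a set \<Rightarrow> ('a \<Rightarrow> 'a \<Rightarrow> bool) \<Rightarrow> real \<Rightarrow> real \<Rightarrow> bool" where
  "edge_markov_type_const V adj p K \<longleftrightarrow>
     (\<forall>n a (M :: (nat \<Rightarrow> nat) measure) Z f t.
        markov_chain M n a Z \<and> stationary_chain M n Z \<and> reversible_chain M n a Z \<and>
        f \<in> {1..n} \<rightarrow> V \<and>
        (\<forall>\<omega>\<in>space M. adj (f (Z 0 \<omega>)) (f (Z 1 \<omega>))) \<longrightarrow>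
        prob_space.expectation M (\<lambda>\<omega>. path_dist adj (f (Z t \<omega>)) (f (Z 0 \<omega>)) powr p)
          \<le> K powr p * real t *
             prob_space.expectation M (\<lambda>\<omega>. path_dist adj (f (Z 1 \<omega>)) (f (Z 0 \<omega>)) powr p))"

definition edge_markov_type :: "'a set \<Rightarrow> ('a \<Rightarrow> 'a \<Rightarrow> bool) \<Rightarrow> real \<Rightarrow> bool" where
  "edge_markov_type V adj p \<longleftrightarrow> (\<exists>K>0. edge_markov_type_const V adj p K)"

lemma edge_markov_type_any_sample_space:
  fixes M :: "'w measure"
  assumes K: "edge_markov_type_const V adj p K"
    and chain: "markov_chain M n a Z" "stationary_chain M n Z" "reversible_chain M n a Z"
    and f: "f \<in> {1..n} \<rightarrow> V"
    and edge: "\<And>\<omega>. \<omega> \<in> space M \<Longrightarrow> adj (f (Z 0 \<omega>)) (f (Z 1 \<omega>))"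
  shows "prob_space.expectation M (\<lambda>\<omega>. path_dist adj (f (Z t \<omega>)) (f (Z 0 \<omega>)) powr p)
    \<le> K powr p * real t *
       prob_space.expectation M (\<lambda>\<omega>. path_dist adj (f (Z 1 \<omega>)) (f (Z 0 \<omega>)) powr p)"
proof -
  define P where "P = PiM (UNIV :: nat set) (\<lambda>_. count_space {1..n})"
  define T where "T = (\<lambda>\<omega> t. Z t \<omega>)"
  define R where "R = restrict_space P (T ` space M)"
  define N where "N = distr M R T"
  define Y where "Y = (\<lambda>t (x :: nat \<Rightarrow> nat). x t)"
  have Zm: "Z t \<in> measurable M (count_space {1..n})" for t
    using chain(1) by (auto simp: markov_chain_def)
  have "T \<in> measurable M P"
    unfolding P_def T_def
    by (rule measurable_PiM_single') (use Zm measurable_space[OF Zm] in \<open>simp_all add: PiE_iff\<close>)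
  then have TR: "T \<in> measurable M R"
    unfolding R_def by (intro measurable_restrict_space2) auto
  have Pm: "(\<lambda>x. x t) \<in> measurable P (count_space {1..n})" for t
    unfolding P_def by simp
  have Rm: "(\<lambda>x. x t) \<in> measurable R (count_space {1..n})" for t
    unfolding R_def by (rule measurable_restrict_space1[OF Pm])
  have YN: "Y t \<in> measurable N (count_space {1..n})" for t
    unfolding Y_def N_def using Rm by simp
  have spR: "space R = T ` space M"
    using measurable_space[OF \<open>T \<in> measurable M P\<close>] by (auto simp: R_def space_restrict_space)
  have prb: "prob_space M" using chain(1) by (simp add: markov_chain_def)
  have pN: "prob_space N"
    unfolding N_def by (rule prob_space.prob_space_distr[OF prb TR])
  have pr: "\<P>(x in N. Q x) = \<P>(\<omega> in M. Q (T \<omega>))" if "{x \<in> space R. Q x} \<in> sets R" for Q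
  proof -
    have "\<P>(x in N. Q x) = measure M (T -` {x \<in> space R. Q x} \<inter> space M)"
      using measure_distr[OF TR that] by (simp add: N_def)
    also have "T -` {x \<in> space R. Q x} \<inter> space M = {\<omega> \<in> space M. Q (T \<omega>)}"
      by (auto simp: spR)
    finally show ?thesis .
  qed
  have s1: "Measurable.pred R (\<lambda>x. x t = j)" for t j
    using measurable_compose[OF Rm, of "\<lambda>k. k = j" "count_space UNIV"] by simp
  have s2: "Measurable.pred R (\<lambda>x. \<forall>s\<le>t. x s = i s)" for t :: nat and i
    using s1 by measurable
  have e1: "\<P>(x in N. Y t x = j) = \<P>(\<omega> in M. Z t \<omega> = j)" for t j
    unfolding Y_def using pr[OF s1[unfolded pred_def]] unfolding T_def .
  have e2: "\<P>(x in N. \<forall>s\<le>t. Y s x = i s) = \<P>(\<omega> in M. \<forall>s\<le>t. Z s \<omega> = i s)" for t i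
    unfolding Y_def using pr[OF s2[unfolded pred_def]] unfolding T_def .
  have e3: "\<P>(x in N. Y (Suc t) x = j \<and> (\<forall>s\<le>t. Y s x = i s)) =
      \<P>(\<omega> in M. Z (Suc t) \<omega> = j \<and> (\<forall>s\<le>t. Z s \<omega> = i s))" for t i j
    unfolding Y_def using pr[OF pred_intros_logic(3)[OF s1 s2, unfolded pred_def]] unfolding T_def .
  have "markov_chain N n a Y"
    using chain(1) pN YN unfolding markov_chain_def cond_prob_def e2 e3 by blast
  moreover have "stationary_chain N n Y"
    using chain(2) unfolding stationary_chain_def e1 .
  moreover have "reversible_chain N n a Y"
    using chain(3) unfolding reversible_chain_def e1 .
  moreover have "\<forall>x\<in>space N. adj (f (Y 0 x)) (f (Y 1 x))"
    using edge by (auto simp: N_def spR Y_def T_def)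
  ultimately have *: "prob_space.expectation N (\<lambda>x. path_dist adj (f (Y t x)) (f (Y 0 x)) powr p)
    \<le> K powr p * real t *
       prob_space.expectation N (\<lambda>x. path_dist adj (f (Y 1 x)) (f (Y 0 x)) powr p)"
    using K f unfolding edge_markov_type_const_def by blast
  have "prob_space.expectation N (\<lambda>x. path_dist adj (f (Y t x)) (f (Y 0 x)) powr p) =
      prob_space.expectation M (\<lambda>\<omega>. path_dist adj (f (Z t \<omega>)) (f (Z 0 \<omega>)) powr p)" for t
  proof -
    have "(\<lambda>x. (x t, x 0)) \<in> measurable R (count_space {1..n} \<Otimes>\<^sub>M count_space {1..n})"
      using Rm by simp
    then have "(\<lambda>x. (x t, x 0)) \<in> measurable R (count_space ({1..n} \<times> {1..n}))"
      by (simp add: pair_measure_count_space)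
    from measurable_compose[OF this, of "\<lambda>(u, v). path_dist adj (f u) (f v) powr p" borel]
    have "(\<lambda>x. path_dist adj (f (x t)) (f (x 0)) powr p) \<in> borel_measurable R"
      by simp
    from integral_distr[OF TR this] show ?thesis
      by (simp add: N_def Y_def T_def)
  qed
  with * show ?thesis by simp
qed

section \<open>Enflo type\<close>

text \<open>The cube \<open>{-1,1}\<^sup>n\<close> consists of functions on \<open>{1..n}\<close>, extended by \<^const>\<open>undefined\<close>.\<close>

definition sign_cube :: "nat \<Rightarrow> (nat \<Rightarrow> int) set" where
  "sign_cube n = {1..n} \<rightarrow>\<^sub>E {- 1, 1}"

definition cube_neg :: "nat \<Rightarrow> (nat \<Rightarrow> int) \<Rightarrow> nat \<Rightarrow> int" where
  "cube_neg n \<epsilon> = (\<lambda>i\<in>{1..n}. - \<epsilon> i)"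

definition enflo_type :: "'a set \<Rightarrow> ('a \<Rightarrow> 'a \<Rightarrow> real) \<Rightarrow> real \<Rightarrow> bool" where
  "enflo_type X d p \<longleftrightarrow>
     (\<exists>K>0. \<forall>n. \<forall>f \<in> sign_cube n \<rightarrow> X.
        measure_pmf.expectation (pmf_of_set (sign_cube n))
          (\<lambda>\<epsilon>. d (f \<epsilon>) (f (cube_neg n \<epsilon>)) powr p)
        \<le> K powr p * (\<Sum>j=1..n.
             measure_pmf.expectation (pmf_of_set (sign_cube n))
               (\<lambda>\<epsilon>. d (f \<epsilon>) (f (\<epsilon>(j := - \<epsilon> j))) powr p)))"

end

theory Submission
  imports Defs "HOL-Real_Asymp.Real_Asymp"
begin

text \<open>
  The positive half transfers the Markov type \<open>2\<close> of Hilbert space through an embedding. Suppose that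
  a squared Hilbertian distance \<open>Q\<close> on the wreath product is bounded along edges and satisfies
  \<open>d\<^sup>p \<le> C Q\<close>. Then \<open>E d(Z\<^sub>t, Z\<^sub>0)\<^sup>p \<le> C E Q(Z\<^sub>t, Z\<^sub>0) \<le> C t E Q(Z\<^sub>1, Z\<^sub>0) = O(t)\<close>,
  and this is the edge Markov inequality because adjacent vertices are at distance at least \<open>1\<close>.

  Markov type \<open>2\<close> is proved for real functions on the state space
  (\<open>linear_growth_sq_dist\<close>) and added up over coordinates. In terms of the self-adjoint transition
  operator \<open>P\<close> it says \<open>\<langle>h, h\<rangle> - \<langle>h, P\<^sup>t h\<rangle> \<le> t (\<langle>h, h\<rangle> - \<langle>h, P h\<rangle>)\<close>. The spectral theorem is avoided by
  bounding each single decrement, which only takes \<open>I + P \<ge> 0\<close> and \<open>(I - P)\<^sup>2 \<ge> 0\<close>.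

  Up to constants, the word metric between \<open>(f, x)\<close> and \<open>(g, y)\<close> is \<open>\<bar>x - y\<bar> + r + D\<close>, where \<open>r\<close> is the
  greatest distance from \<open>x\<close> to a place where \<open>f\<close> and \<open>g\<close> differ and \<open>D = \<Sum>\<bar>f - g\<bar>\<close>. The Hilbertian
  kernel (\<open>kernel\<close>) has three kinds of coordinates. The position and the lamps themselves give
  \<open>\<bar>x - y\<bar>\<^sup>2\<close> and \<open>S = \<Sum>\<bar>f - g\<bar>\<^sup>2\<close>. For the range there is, for each place \<open>z\<close>, an orthonormal family indexed by
  the configurations on \<open>[z, \<infinity>)\<close>, whose vectors carry the weight \<open>(z - x)\<^sup>\<beta>\<close> when \<open>z > x\<close> and vanish otherwise.
  The lamplighter at \<open>x\<close> cannot change a configuration that carries a nonzero weight, and a step to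
  the side costs \<open>\<Sum>((k + 1)\<^sup>\<beta> - k\<^sup>\<beta>)\<^sup>2\<close>, which is finite exactly for \<open>\<beta> < 1/2\<close>. Since all
  configurations between \<open>x\<close> and the farthest differing place are distinct, these coordinates
  dominate \<open>\<Sum>k\<^sup>2\<^sup>\<beta>\<close> over \<open>1 \<le> k \<le> r\<close>, hence a multiple of \<open>r\<^sup>s\<close> with \<open>s = 2\<beta> + 1 < 2\<close>. Finally \<open>D\<^sup>2 \<le> (2r + 1) S\<close>, so \<open>D\<close> can only be
  large if \<open>S\<close> or \<open>r\<close> is; optimising gives \<open>D\<^sup>p \<le> O(S + r\<^sup>s)\<close> with \<open>s = p / (2 - p)\<close>. The
  requirement \<open>s < 2\<close> is exactly \<open>p < 4/3\<close>.

  Enflo type fails because the lamps form an \<open>\<ell>\<^sub>1\<close> space in which the first \<open>n\<close> coordinates are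
  reached by a walk of length \<open>n\<close>. Writing \<open>n \<epsilon>\<^sub>j\<close> into the lamp at \<open>j\<close> for \<open>1 \<le> j \<le> n\<close> puts antipodes at distance at least \<open>2n\<^sup>2\<close>,
  while a flip of one sign costs at most \<open>8n\<close>. Type \<open>p\<close> would force \<open>n\<^sup>2\<^sup>p = O(n \<cdot> n\<^sup>p)\<close> for all \<open>n\<close>, so \<open>p \<le> 1\<close>.
\<close>

section \<open>Markov type two of the real line\<close>

locale reversible_stationary_chain =
  fixes M :: "'w measure" and n :: nat and a :: "nat \<Rightarrow> nat \<Rightarrow> real" and Z :: "nat \<Rightarrow> 'w \<Rightarrow> nat"
  assumes chain: "markov_chain M n a Z"
    and stationary: "stationary_chain M n Z"
    and reversible: "reversible_chain M n a Z"
begin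

sublocale prob_space M
  using chain by (simp add: markov_chain_def)

lemma Z_measurable: "Z t \<in> measurable M (count_space {1..n})"
  using chain by (simp add: markov_chain_def)

lemma Z_measurable_UNIV [measurable]: "Z t \<in> measurable M (count_space UNIV)"
  using measurable_compose[OF Z_measurable, of "\<lambda>k. k" "count_space UNIV"] by simp

lemma Z_in_states: "\<omega> \<in> space M \<Longrightarrow> Z t \<omega> \<in> {1..n}"
  using measurable_space[OF Z_measurable] by simp

definition weight :: "nat \<Rightarrow> real" where
  "weight i = \<P>(\<omega> in M. Z 0 \<omega> = i)"

definition transition :: "(nat \<Rightarrow> real) \<Rightarrow> nat \<Rightarrow> real" where
  "transition h i = (\<Sum>j=1..n. a i j * h j)"

definition ip :: "(nat \<Rightarrow> real) \<Rightarrow> (nat \<Rightarrow> real) \<Rightarrow> real" where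
  "ip g h = (\<Sum>i=1..n. weight i * g i * h i)"

lemma weight_nonneg: "0 \<le> weight i"
  by (simp add: weight_def)

lemma a_nonneg: "i \<in> {1..n} \<Longrightarrow> j \<in> {1..n} \<Longrightarrow> 0 \<le> a i j"
  using chain by (simp add: markov_chain_def)

lemma a_sum: "i \<in> {1..n} \<Longrightarrow> (\<Sum>j=1..n. a i j) = 1"
  using chain by (simp add: markov_chain_def)

lemma detailed_balance: "i \<in> {1..n} \<Longrightarrow> j \<in> {1..n} \<Longrightarrow> weight i * a i j = weight j * a j i"
  using reversible by (simp add: reversible_chain_def weight_def)

lemma ip_commute: "ip g h = ip h g"
  by (simp add: ip_def mult_ac)

lemma ip_diff_left: "ip (\<lambda>i. g i - h i) k = ip g k - ip h k"
  by (simp add: ip_def algebra_simps sum_subtractf)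

lemma ip_diff_right: "ip k (\<lambda>i. g i - h i) = ip k g - ip k h"
  by (simp add: ip_def algebra_simps sum_subtractf)

lemma ip_self_nonneg: "0 \<le> ip g g"
  by (auto simp: ip_def mult.assoc intro!: sum_nonneg mult_nonneg_nonneg[OF weight_nonneg zero_le_square])

lemma transition_diff: "transition (\<lambda>i. g i - h i) = (\<lambda>i. transition g i - transition h i)"
  by (simp add: transition_def algebra_simps sum_subtractf fun_eq_iff)

lemma ip_transition: "ip g (transition h) = (\<Sum>i=1..n. \<Sum>j=1..n. weight i * a i j * (g i * h j))"
  by (simp add: ip_def transition_def sum_distrib_left mult_ac)

lemma transition_selfadjoint: "ip (transition g) h = ip g (transition h)"
proof -
  have "ip (transition g) h = (\<Sum>i=1..n. \<Sum>j=1..n. weight i * a i j * (h i * g j))"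
    by (simp add: ip_commute[of _ h] ip_transition)
  also have "\<dots> = (\<Sum>j=1..n. \<Sum>i=1..n. weight i * a i j * (h i * g j))"
    by (rule sum.swap)
  also have "\<dots> = (\<Sum>j=1..n. \<Sum>i=1..n. weight j * a j i * (g j * h i))"
    by (intro sum.cong refl) (subst detailed_balance, auto)
  finally show ?thesis by (simp add: ip_transition)
qed

text \<open>Positivity of \<open>I + P\<close>: by stationarity and detailed balance, \<open>2 (\<langle>g, g\<rangle> + \<langle>g, P g\<rangle>)\<close> is the
  expectation of \<open>(g(Z\<^sub>0) + g(Z\<^sub>1))\<^sup>2\<close>.\<close>

lemma ip_plus_transition_nonneg: "0 \<le> ip g g + ip g (transition g)"
proof -
  have 1: "(\<Sum>i=1..n. \<Sum>j=1..n. weight i * a i j * (g i)\<^sup>2) = ip g g"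
  proof -
    have "(\<Sum>j=1..n. weight i * a i j * (g i)\<^sup>2) = weight i * g i * g i" if "i \<in> {1..n}" for i
    proof -
      have "(\<Sum>j=1..n. weight i * a i j * (g i)\<^sup>2) = weight i * (g i)\<^sup>2 * (\<Sum>j=1..n. a i j)"
        by (simp add: sum_distrib_left mult_ac)
      also have "\<dots> = weight i * g i * g i"
        unfolding a_sum[OF that] by (simp add: power2_eq_square)
      finally show ?thesis .
    qed
    then show ?thesis by (simp add: ip_def)
  qed
  have 2: "(\<Sum>i=1..n. \<Sum>j=1..n. weight i * a i j * (g j)\<^sup>2) = ip g g"
  proof -
    have "(\<Sum>i=1..n. \<Sum>j=1..n. weight i * a i j * (g j)\<^sup>2) =
        (\<Sum>j=1..n. \<Sum>i=1..n. weight i * a i j * (g j)\<^sup>2)"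
      by (rule sum.swap)
    also have "\<dots> = (\<Sum>j=1..n. \<Sum>i=1..n. weight j * a j i * (g j)\<^sup>2)"
      by (intro sum.cong refl) (subst detailed_balance, auto)
    finally show ?thesis using 1 by simp
  qed
  have "0 \<le> (\<Sum>i=1..n. \<Sum>j=1..n. weight i * a i j * (g i + g j)\<^sup>2)"
    by (intro sum_nonneg mult_nonneg_nonneg weight_nonneg a_nonneg) auto
  also have "\<dots> = (\<Sum>i=1..n. \<Sum>j=1..n. weight i * a i j * (g i)\<^sup>2)
      + (\<Sum>i=1..n. \<Sum>j=1..n. weight i * a i j * (g j)\<^sup>2)
      + 2 * (\<Sum>i=1..n. \<Sum>j=1..n. weight i * a i j * (g i * g j))"
    by (simp add: sum_distrib_left sum.distrib[symmetric] power2_sum algebra_simps)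
  finally show ?thesis unfolding 1 2 ip_transition[symmetric] by simp
qed

definition energy :: "(nat \<Rightarrow> real) \<Rightarrow> real" where
  "energy g = ip g g - ip g (transition g)"

text \<open>With \<open>u = g - P g\<close>, the difference of the two sides is \<open>\<langle>u, u\<rangle> + \<langle>u, P u\<rangle>\<close>, because
  \<open>(I - P) - P (I - P) P = (I - P) (I + P) (I - P)\<close>.\<close>

lemma energy_transition_le: "energy (transition g) \<le> energy g"
  using ip_plus_transition_nonneg[of "\<lambda>i. g i - transition g i"]
    transition_selfadjoint[of g "transition g"] transition_selfadjoint[of g g]
  by (simp add: energy_def transition_diff ip_diff_left ip_diff_right ip_commute)

lemma energy_funpow_le: "energy ((transition ^^ m) g) \<le> energy g"
  by (induction m) (auto intro: order_trans[OF energy_transition_le])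

text \<open>The difference of the two sides is \<open>\<langle>u, u\<rangle>\<close> with \<open>u = g - P g\<close>.\<close>

lemma ip_transition_decrement_le:
  "ip g (transition g) - ip (transition g) (transition g) \<le> energy g"
  using ip_self_nonneg[of "\<lambda>i. g i - transition g i"] transition_selfadjoint[of g g]
  by (simp add: energy_def ip_diff_left ip_diff_right ip_commute)

lemma ip_funpow_add:
  "ip h ((transition ^^ (m + k)) h) = ip ((transition ^^ m) h) ((transition ^^ k) h)"
proof (induction m arbitrary: k)
  case (Suc m)
  have "ip h ((transition ^^ (Suc m + k)) h) = ip h ((transition ^^ (m + Suc k)) h)" by simp
  also have "\<dots> = ip ((transition ^^ m) h) (transition ((transition ^^ k) h))"
    using Suc.IH[of "Suc k"] by simp
  also have "\<dots> = ip (transition ((transition ^^ m) h)) ((transition ^^ k) h)"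
    by (rule transition_selfadjoint[symmetric])
  finally show ?case by simp
qed simp

text \<open>By self-adjointness half of the \<open>s\<close> steps can be moved to the left argument. For \<open>s = 2m\<close> the
  decrement is then the energy of \<open>P\<^sup>m h\<close>; for odd \<open>s\<close> one step is left over, which
  \<open>ip_transition_decrement_le\<close> absorbs.\<close>

lemma correlation_decrement_le:
  "ip h ((transition ^^ s) h) - ip h ((transition ^^ Suc s) h) \<le> energy h"
proof (cases "even s")
  case True
  then obtain m where s: "s = m + m" by (metis evenE mult_2)
  have "ip h ((transition ^^ s) h) - ip h ((transition ^^ Suc s) h)
      = energy ((transition ^^ m) h)"
    using ip_funpow_add[of h m m] ip_funpow_add[of h m "Suc m"] s by (simp add: energy_def)
  then show ?thesis using energy_funpow_le by simp
next
  case False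
  then obtain m where s: "s = m + Suc m" by (metis add_Suc_right oddE Suc_eq_plus1 mult_2)
  define g where "g = (transition ^^ m) h"
  have "ip h ((transition ^^ s) h) - ip h ((transition ^^ Suc s) h)
      = ip g (transition g) - ip (transition g) (transition g)"
    using ip_funpow_add[of h m "Suc m"] ip_funpow_add[of h "Suc m" "Suc m"] s
    by (simp add: g_def)
  also have "\<dots> \<le> energy g" by (rule ip_transition_decrement_le)
  finally show ?thesis using energy_funpow_le[of m h] by (simp add: g_def)
qed

lemma correlation_drop_le: "ip h h - ip h ((transition ^^ t) h) \<le> real t * energy h"
proof (induction t)
  case (Suc t)
  then show ?case using correlation_decrement_le[of h t] by (simp add: algebra_simps)
qed simp

lemma integrable_states: "integrable M (\<lambda>\<omega>. F (Z s \<omega>) (Z t \<omega>) :: real)"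
proof (rule integrable_const_bound)
  let ?B = "\<Sum>i=1..n. \<Sum>j=1..n. \<bar>F i j\<bar>"
  have "\<bar>F i j\<bar> \<le> ?B" if "i \<in> {1..n}" "j \<in> {1..n}" for i j
    using member_le_sum[OF that(2), of "\<lambda>j. \<bar>F i j\<bar>"]
      member_le_sum[OF that(1), of "\<lambda>i. \<Sum>j=1..n. \<bar>F i j\<bar>"] by (simp add: sum_nonneg)
  then show "AE \<omega> in M. norm (F (Z s \<omega>) (Z t \<omega>)) \<le> ?B"
    using Z_in_states by auto
  show "(\<lambda>\<omega>. F (Z s \<omega>) (Z t \<omega>)) \<in> borel_measurable M"
  proof (rule measurable_compose_countable[of "\<lambda>i \<omega>. F i (Z t \<omega>)" M borel "Z s"])
    show "(\<lambda>\<omega>. F i (Z t \<omega>)) \<in> borel_measurable M" for i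
      using measurable_compose[OF Z_measurable_UNIV, of "F i" borel t] by simp
  qed simp
qed

lemma expectation_step_function:
  fixes c :: "'x \<Rightarrow> real"
  assumes "\<And>x. F x \<in> events"
  shows "expectation (\<lambda>\<omega>. \<Sum>x\<in>X. c x * indicator (F x) \<omega>) = (\<Sum>x\<in>X. c x * prob (F x))"
proof -
  have int: "integrable M (\<lambda>\<omega>. indicator (F x) \<omega> :: real)" for x
    using assms by (intro integrable_real_indicator) (simp_all add: emeasure_eq_measure)
  have "expectation (\<lambda>\<omega>. \<Sum>x\<in>X. c x * indicator (F x) \<omega>)
      = (\<Sum>x\<in>X. expectation (\<lambda>\<omega>. c x * indicator (F x) \<omega>))"
    by (rule Bochner_Integration.integral_sum) (rule integrable_mult_right, rule int)
  then show ?thesis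
    using assms by (simp add: Int_absorb1 sets.sets_into_space)
qed

lemma Z_event: "{\<omega> \<in> space M. Z t \<omega> = i} \<in> events"
proof -
  have "Z t -` {i} \<inter> space M \<in> events"
    by (rule measurable_sets[OF Z_measurable_UNIV]) simp
  then show ?thesis by (simp add: vimage_def Int_def conj_commute)
qed

lemma expectation_one_time: "expectation (\<lambda>\<omega>. g (Z t \<omega>)) = (\<Sum>i=1..n. weight i * g i)"
proof -
  have "expectation (\<lambda>\<omega>. g (Z t \<omega>))
      = expectation (\<lambda>\<omega>. \<Sum>i=1..n. g i * indicator {\<omega> \<in> space M. Z t \<omega> = i} \<omega>)"
  proof (rule Bochner_Integration.integral_cong[OF refl])
    fix \<omega> assume \<omega>: "\<omega> \<in> space M"
    have "(\<Sum>i=1..n. g i * indicator {\<omega> \<in> space M. Z t \<omega> = i} \<omega>)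
        = (\<Sum>i=1..n. if i = Z t \<omega> then g i else 0)"
      by (intro sum.cong) (auto simp: \<omega> indicator_def)
    then show "g (Z t \<omega>) = (\<Sum>i=1..n. g i * indicator {\<omega> \<in> space M. Z t \<omega> = i} \<omega>)"
      using Z_in_states[OF \<omega>, of t] by simp
  qed
  also have "\<dots> = (\<Sum>i=1..n. g i * prob {\<omega> \<in> space M. Z t \<omega> = i})"
    by (rule expectation_step_function[OF Z_event])
  also have "\<dots> = (\<Sum>i=1..n. weight i * g i)"
  proof (intro sum.cong refl)
    fix i assume "i \<in> {1..n}"
    then have "\<P>(\<omega> in M. Z t \<omega> = i) = weight i"
      using stationary unfolding stationary_chain_def weight_def by blast
    then show "g i * \<P>(\<omega> in M. Z t \<omega> = i) = weight i * g i" by simp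
  qed
  finally show ?thesis .
qed

text \<open>The Markov property is given for full histories, so the sample space is cut into the finitely
  many histories up to time \<open>t\<close> before the next step is averaged out.\<close>

lemma expectation_transition:
  "expectation (\<lambda>\<omega>. k (Z 0 \<omega>) * h (Z (Suc t) \<omega>)) =
   expectation (\<lambda>\<omega>. k (Z 0 \<omega>) * transition h (Z t \<omega>))"
proof -
  define I where "I = ({..t} \<rightarrow>\<^sub>E {1..n})"
  define E where "E = (\<lambda>i. {\<omega> \<in> space M. \<forall>s\<le>t. Z s \<omega> = i s})"
  define E' where "E' = (\<lambda>i j. {\<omega> \<in> space M. Z (Suc t) \<omega> = j \<and> (\<forall>s\<le>t. Z s \<omega> = i s)})"
  have finI: "finite I" unfolding I_def by (intro finite_PiE) auto
  have meas: "E i \<in> events" "E' i j \<in> events" for i j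
    unfolding E_def E'_def by measurable
  have split: "G (\<lambda>s\<in>{..t}. Z s \<omega>) = (\<Sum>i\<in>I. G i * indicator (E i) \<omega>)"
    if \<omega>: "\<omega> \<in> space M" for \<omega> and G :: "(nat \<Rightarrow> nat) \<Rightarrow> real"
  proof -
    let ?i = "\<lambda>s\<in>{..t}. Z s \<omega>"
    have "?i \<in> I" using Z_in_states[OF \<omega>] by (auto simp: I_def)
    moreover have "\<omega> \<in> E i \<longleftrightarrow> i = ?i" if "i \<in> I" for i
      using that \<omega> by (auto simp: E_def I_def PiE_def extensional_def fun_eq_iff)
    then have "(\<Sum>i\<in>I. G i * indicator (E i) \<omega>) = (\<Sum>i\<in>I. if i = ?i then G i else 0)"
      by (intro sum.cong) (auto simp: indicator_def)
    ultimately show ?thesis using finI by simp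
  qed
  have step: "prob (E' i j) = prob (E i) * a (i t) j" if "i \<in> I" "j \<in> {1..n}" for i j
  proof (cases "prob (E i) = 0")
    case True
    have "prob (E' i j) \<le> prob (E i)"
      by (rule finite_measure_mono) (auto simp: E_def E'_def meas(1)[unfolded E_def])
    then show ?thesis using True measure_nonneg[of M "E' i j"] by simp
  next
    case False
    then have pos: "prob (E i) > 0" by (simp add: zero_less_measure_iff)
    then have "\<P>(\<omega> in M. Z (Suc t) \<omega> = j \<bar> \<forall>s\<le>t. Z s \<omega> = i s) = a (i t) j"
      using chain that(2) unfolding markov_chain_def E_def by blast
    then show ?thesis
      using pos by (simp add: cond_prob_def E_def E'_def field_simps)
  qed
  have "expectation (\<lambda>\<omega>. k (Z 0 \<omega>) * h (Z (Suc t) \<omega>))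
      = expectation (\<lambda>\<omega>. \<Sum>i\<in>I. \<Sum>j=1..n. k (i 0) * h j * indicator (E' i j) \<omega>)"
  proof (rule Bochner_Integration.integral_cong[OF refl])
    fix \<omega> assume \<omega>: "\<omega> \<in> space M"
    have *: "indicator (E' i j) \<omega> = indicator (E i) \<omega> * (if j = Z (Suc t) \<omega> then 1 else 0 :: real)" for i j
      using \<omega> by (auto simp: E_def E'_def indicator_def)
    have "(\<Sum>i\<in>I. \<Sum>j=1..n. k (i 0) * h j * indicator (E' i j) \<omega>)
        = (\<Sum>i\<in>I. k (i 0) * indicator (E i) \<omega> * (\<Sum>j=1..n. if j = Z (Suc t) \<omega> then h j else 0))"
      unfolding * sum_distrib_left by (intro sum.cong) auto
    also have "\<dots> = (\<Sum>i\<in>I. k (i 0) * indicator (E i) \<omega> * h (Z (Suc t) \<omega>))"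
      using Z_in_states[OF \<omega>, of "Suc t"] by simp
    also have "\<dots> = (\<Sum>i\<in>I. k (i 0) * indicator (E i) \<omega>) * h (Z (Suc t) \<omega>)"
      by (simp add: sum_distrib_right)
    finally show "k (Z 0 \<omega>) * h (Z (Suc t) \<omega>)
        = (\<Sum>i\<in>I. \<Sum>j=1..n. k (i 0) * h j * indicator (E' i j) \<omega>)"
      using split[OF \<omega>, of "\<lambda>i. k (i 0)"] by simp
  qed
  also have "\<dots> = (\<Sum>i\<in>I. \<Sum>j=1..n. k (i 0) * h j * prob (E' i j))"
    unfolding sum.cartesian_product
    using expectation_step_function[where F = "\<lambda>(i, j). E' i j" and X = "I \<times> {1..n}"
        and c = "\<lambda>(i, j). k (i 0) * h j"] meas(2)
    by (simp add: case_prod_unfold)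
  also have "\<dots> = (\<Sum>i\<in>I. k (i 0) * transition h (i t) * prob (E i))"
    by (intro sum.cong refl) (simp add: step transition_def sum_distrib_left sum_distrib_right mult_ac)
  also have "\<dots> = expectation (\<lambda>\<omega>. \<Sum>i\<in>I. k (i 0) * transition h (i t) * indicator (E i) \<omega>)"
    by (rule expectation_step_function[OF meas(1), symmetric])
  also have "\<dots> = expectation (\<lambda>\<omega>. k (Z 0 \<omega>) * transition h (Z t \<omega>))"
    by (rule Bochner_Integration.integral_cong[OF refl])
      (use split[of _ "\<lambda>i. k (i 0) * transition h (i t)"] in simp)
  finally show ?thesis .
qed

lemma expectation_correlation:
  "expectation (\<lambda>\<omega>. k (Z 0 \<omega>) * h (Z t \<omega>)) = ip k ((transition ^^ t) h)"
proof (induction t arbitrary: h)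
  case 0
  show ?case
    using expectation_one_time[of "\<lambda>i. k i * h i" 0] by (simp add: ip_def mult_ac)
next
  case (Suc t)
  show ?case by (simp only: expectation_transition Suc.IH funpow_Suc_right o_apply)
qed

lemma expectation_increment_sq:
  "expectation (\<lambda>\<omega>. (h (Z t \<omega>) - h (Z 0 \<omega>))\<^sup>2) = 2 * (ip h h - ip h ((transition ^^ t) h))"
proof -
  have "expectation (\<lambda>\<omega>. (h (Z t \<omega>) - h (Z 0 \<omega>))\<^sup>2)
      = expectation (\<lambda>\<omega>. (h (Z t \<omega>))\<^sup>2 + (h (Z 0 \<omega>))\<^sup>2 - 2 * (h (Z 0 \<omega>) * h (Z t \<omega>)))"
    by (simp add: power2_diff mult_ac)
  also have "\<dots> = expectation (\<lambda>\<omega>. (h (Z t \<omega>))\<^sup>2) + expectation (\<lambda>\<omega>. (h (Z 0 \<omega>))\<^sup>2)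
      - 2 * expectation (\<lambda>\<omega>. h (Z 0 \<omega>) * h (Z t \<omega>))"
    using integrable_states[of "\<lambda>i j. (h j)\<^sup>2" 0 t] integrable_states[of "\<lambda>i j. (h j)\<^sup>2" 0 0]
      integrable_states[of "\<lambda>i j. h i * h j" 0 t] by simp
  also have "\<dots> = 2 * (ip h h - ip h ((transition ^^ t) h))"
    using expectation_one_time[of "\<lambda>i. (h i)\<^sup>2"] expectation_correlation
    by (simp add: ip_def power2_eq_square mult_ac)
  finally show ?thesis .
qed

text \<open>The Markov type \<open>2\<close> inequality with constant \<open>1\<close>, as a property of a squared distance \<open>Q\<close>
  pulled back to the state space. It is linear in \<open>Q\<close>, which reduces Hilbert space to the real line.\<close>

definition linear_growth :: "(nat \<Rightarrow> nat \<Rightarrow> real) \<Rightarrow> bool" where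
  "linear_growth Q \<longleftrightarrow>
    (\<forall>t. expectation (\<lambda>\<omega>. Q (Z t \<omega>) (Z 0 \<omega>)) \<le> real t * expectation (\<lambda>\<omega>. Q (Z 1 \<omega>) (Z 0 \<omega>)))"

lemma linear_growth_sq_dist: "linear_growth (\<lambda>i j. (h i - h j)\<^sup>2)"
  unfolding linear_growth_def expectation_increment_sq
proof
  show "2 * (ip h h - ip h ((transition ^^ t) h)) \<le> real t * (2 * (ip h h - ip h ((transition ^^ 1) h)))"
    for t
  proof -
    have "2 * (ip h h - ip h ((transition ^^ t) h)) \<le> 2 * (real t * energy h)"
      using correlation_drop_le[of h t] by simp
    also have "\<dots> = real t * (2 * energy h)" by simp
    also have "energy h = ip h h - ip h ((transition ^^ 1) h)" by (simp add: energy_def)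
    finally show ?thesis .
  qed
qed

lemma linear_growth_sum:
  assumes "\<And>c. c \<in> C \<Longrightarrow> linear_growth (Q c)"
  shows "linear_growth (\<lambda>i j. \<Sum>c\<in>C. Q c i j)"
  using assms integrable_states unfolding linear_growth_def
  by (simp add: Bochner_Integration.integral_sum sum_distrib_left sum_mono)

lemma linear_growth_add:
  assumes "linear_growth Q" "linear_growth Q'"
  shows "linear_growth (\<lambda>i j. Q i j + Q' i j)"
  using linear_growth_sum[of "{True, False}" "\<lambda>b. if b then Q else Q'"] assms by simp

lemma linear_growth_cong:
  assumes "linear_growth Q" "\<And>i j. i \<in> {1..n} \<Longrightarrow> j \<in> {1..n} \<Longrightarrow> Q' i j = Q i j"
  shows "linear_growth Q'"
proof -
  have "expectation (\<lambda>\<omega>. Q' (Z t \<omega>) (Z 0 \<omega>)) = expectation (\<lambda>\<omega>. Q (Z t \<omega>) (Z 0 \<omega>))" for t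
    by (rule Bochner_Integration.integral_cong) (use assms(2) Z_in_states in auto)
  then show ?thesis using assms(1) by (simp add: linear_growth_def)
qed

end

section \<open>The word metric\<close>

lemma wreath_ZZ_adj_cases:
  assumes "wreath_ZZ_adj (f, x) (g, y)"
  shows "g = f \<and> \<bar>y - x\<bar> = 1 \<or> y = x \<and> \<bar>g x - f x\<bar> = 1 \<and> (\<forall>z. z \<noteq> x \<longrightarrow> g z = f z)"
  using assms
  by (auto simp: wreath_ZZ_adj_def cayley_adj_def wreath_ZZ_gens_def wreath_ZZ_def delta0_def)

lemma path_dist_le_walk: "(adj ^^ k) u v \<Longrightarrow> path_dist adj u v \<le> real k"
  by (simp add: path_dist_def Least_le)

text \<open>Lower bounds on the word metric come from functions that grow by at most \<open>1\<close> along an edge.\<close>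

lemma walk_lipschitz:
  fixes \<phi> :: "'a \<Rightarrow> real"
  assumes "\<And>u v. adj u v \<Longrightarrow> \<phi> v \<le> \<phi> u + 1"
  shows "(adj ^^ k) u v \<Longrightarrow> \<phi> v \<le> \<phi> u + real k"
proof (induction k arbitrary: v)
  case (Suc k)
  from Suc.prems obtain w where w: "(adj ^^ k) u w" "adj w v" by (rule relpowp_Suc_E)
  show ?case using Suc.IH[OF w(1)] assms[OF w(2)] by simp
qed simp

lemma move_walk:
  assumes "finite {z. f z \<noteq> 0}"
  shows "(wreath_ZZ_adj ^^ nat \<bar>y - x\<bar>) (f, x) (f, y)"
proof -
  have up: "(wreath_ZZ_adj ^^ k) (f, x) (f, x + int k)" for k
  proof (induction k)
    case (Suc k)
    have "wreath_ZZ_adj (f, x + int k) (f, x + int (Suc k))"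
      using wreath_ZZ_adj_steps(1)[OF assms, of "x + int k"] by (simp add: ac_simps)
    with Suc show ?case by (rule relpowp_Suc_I)
  qed simp
  have down: "(wreath_ZZ_adj ^^ k) (f, x) (f, x - int k)" for k
  proof (induction k)
    case (Suc k)
    have "wreath_ZZ_adj (f, x - int k) (f, x - int (Suc k))"
      using wreath_ZZ_adj_steps(2)[OF assms, of "x - int k"] by (simp add: algebra_simps)
    with Suc show ?case by (rule relpowp_Suc_I)
  qed simp
  show ?thesis
    using up[of "nat (y - x)"] down[of "nat (x - y)"] by (cases "x \<le> y") auto
qed

lemma finite_support_fun_upd:
  "finite {z. f z \<noteq> 0} \<Longrightarrow> finite {z. (f(x := c)) z \<noteq> (0::int)}"
  by (rule finite_subset[of _ "insert x {z. f z \<noteq> 0}"]) auto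

lemma switch_walk:
  assumes "finite {z. f z \<noteq> 0}"
  shows "(wreath_ZZ_adj ^^ nat \<bar>c - f x\<bar>) (f, x) (f(x := c), x)"
proof -
  have up: "(wreath_ZZ_adj ^^ k) (f, x) (f(x := f x + int k), x)" for k
  proof (induction k)
    case (Suc k)
    have "wreath_ZZ_adj (f(x := f x + int k), x) (f(x := f x + int (Suc k)), x)"
    proof -
      have "f x + int (Suc k) = f x + int k + 1" by simp
      then show ?thesis
        using wreath_ZZ_adj_steps(3)[OF finite_support_fun_upd[OF assms, of x "f x + int k"], of x]
        by (simp only: fun_upd_same fun_upd_upd)
    qed
    with Suc show ?case by (rule relpowp_Suc_I)
  qed simp
  have down: "(wreath_ZZ_adj ^^ k) (f, x) (f(x := f x - int k), x)" for k
  proof (induction k)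
    case (Suc k)
    have "wreath_ZZ_adj (f(x := f x - int k), x) (f(x := f x - int (Suc k)), x)"
    proof -
      have "f x - int (Suc k) = f x - int k - 1" by simp
      then show ?thesis
        using wreath_ZZ_adj_steps(4)[OF finite_support_fun_upd[OF assms, of x "f x - int k"], of x]
        by (simp only: fun_upd_same fun_upd_upd)
    qed
    with Suc show ?case by (rule relpowp_Suc_I)
  qed simp
  show ?thesis
    using up[of "nat (c - f x)"] down[of "nat (f x - c)"] by (cases "f x \<le> c") auto
qed

lemma sweep_walk:
  assumes f: "finite {z. f z \<noteq> 0}" and g: "finite {z. g z \<noteq> 0}"
  shows "(wreath_ZZ_adj ^^ (k + (\<Sum>z\<in>{x..<x + int k}. nat \<bar>g z - f z\<bar>)))
    (f, x) (\<lambda>z. if z \<in> {x..<x + int k} then g z else f z, x + int k)"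
proof (induction k)
  case (Suc k)
  let ?h = "\<lambda>z. if z \<in> {x..<x + int k} then g z else f z"
  let ?y = "x + int k"
  have I: "{x..<x + int (Suc k)} = insert ?y {x..<?y}" by auto
  have fin: "finite {z. ?h z \<noteq> 0}"
    by (rule finite_subset[OF _ finite_UnI[OF f g]]) auto
  have upd: "?h(?y := g ?y) = (\<lambda>z. if z \<in> {x..<x + int (Suc k)} then g z else f z)"
    unfolding I by auto
  have "(wreath_ZZ_adj ^^ nat \<bar>g ?y - ?h ?y\<bar>) (?h, ?y) (?h(?y := g ?y), ?y)"
    by (rule switch_walk[OF fin])
  moreover have "wreath_ZZ_adj (?h(?y := g ?y), ?y) (?h(?y := g ?y), ?y + 1)"
    by (rule wreath_ZZ_adj_steps(1)[OF finite_support_fun_upd[OF fin]])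
  ultimately have "(wreath_ZZ_adj ^^ Suc (nat \<bar>g ?y - ?h ?y\<bar>)) (?h, ?y) (?h(?y := g ?y), ?y + 1)"
    by (rule relpowp_Suc_I)
  from relpowp_trans[OF Suc this] show ?case
    unfolding upd unfolding I by (simp add: ac_simps)
qed simp

lemma wreath_ZZ_dist_move:
  assumes "finite {z. f z \<noteq> 0}"
  shows "wreath_ZZ_dist (f, x) (f, y) \<le> \<bar>real_of_int (x - y)\<bar>"
  using path_dist_le_walk[OF move_walk[OF assms, where x = x and y = y]] unfolding wreath_ZZ_dist_def by linarith

text \<open>The walk goes to the left end \<open>x - r\<close>, corrects all lamps while sweeping to the right, and
  returns from \<open>x + r + 1\<close> to \<open>y\<close>.\<close>

lemma wreath_ZZ_dist_le:
  assumes f: "finite {z. f z \<noteq> 0}" and g: "finite {z. g z \<noteq> 0}"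
    and supp: "\<And>z. f z \<noteq> g z \<Longrightarrow> \<bar>z - x\<bar> \<le> int r"
  shows "wreath_ZZ_dist (f, x) (g, y) \<le> 4 * real r + 2 + \<bar>real_of_int (x - y)\<bar>
    + (\<Sum>z\<in>{x - int r..x + int r}. \<bar>real_of_int (f z - g z)\<bar>)"
proof -
  let ?k = "2 * r + 1"
  have I: "{x - int r..<x - int r + int ?k} = {x - int r..x + int r}" by auto
  have eq: "(\<lambda>z. if z \<in> {x - int r..<x - int r + int ?k} then g z else f z) = g"
    unfolding I using supp by (force simp: fun_eq_iff)
  have sweep: "(wreath_ZZ_adj ^^ (?k + (\<Sum>z\<in>{x - int r..x + int r}. nat \<bar>g z - f z\<bar>)))
      (f, x - int r) (g, x - int r + int ?k)"
    using sweep_walk[OF f g, where k = ?k and x = "x - int r"] unfolding eq unfolding I .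
  have "(wreath_ZZ_adj ^^ (nat \<bar>x - int r - x\<bar> +
      ((?k + (\<Sum>z\<in>{x - int r..x + int r}. nat \<bar>g z - f z\<bar>)) +
        nat \<bar>y - (x - int r + int ?k)\<bar>))) (f, x) (g, y)"
    by (rule relpowp_trans[OF move_walk[OF f] relpowp_trans[OF sweep move_walk[OF g]]])
  then have "wreath_ZZ_dist (f, x) (g, y) \<le> real (nat \<bar>x - int r - x\<bar> +
      ((?k + (\<Sum>z\<in>{x - int r..x + int r}. nat \<bar>g z - f z\<bar>)) +
        nat \<bar>y - (x - int r + int ?k)\<bar>))"
    unfolding wreath_ZZ_dist_def by (rule path_dist_le_walk)
  also have "\<dots> = real r + real ?k + real_of_int \<bar>y - (x - int r + int ?k)\<bar>
      + (\<Sum>z\<in>{x - int r..x + int r}. \<bar>real_of_int (f z - g z)\<bar>)"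
    by (simp add: abs_minus_commute)
  also have "real_of_int \<bar>y - (x - int r + int ?k)\<bar> \<le> \<bar>real_of_int (x - y)\<bar> + real r + 1"
    by simp
  finally show ?thesis by simp
qed

lemma wreath_ZZ_dist_ge:
  assumes "(f, x) \<in> carrier wreath_ZZ" "(g, y) \<in> carrier wreath_ZZ" "finite A"
  shows "(\<Sum>z\<in>A. \<bar>real_of_int (f z - g z)\<bar>) \<le> wreath_ZZ_dist (f, x) (g, y)"
proof -
  define \<phi> where "\<phi> v = (\<Sum>z\<in>A. \<bar>real_of_int (f z - fst v z)\<bar>)" for v :: "(int \<Rightarrow> int) \<times> int"
  have "\<phi> v \<le> \<phi> u + 1" if "wreath_ZZ_adj u v" for u v
  proof -
    obtain h a k b where uv: "u = (h, a)" "v = (k, b)" by (cases u, cases v) auto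
    have "\<phi> v \<le> (\<Sum>z\<in>A. \<bar>real_of_int (f z - h z)\<bar> + (if z = a then 1 else 0))"
      unfolding \<phi>_def uv using wreath_ZZ_adj_cases[OF that[unfolded uv]]
      by (intro sum_mono) auto
    also have "\<dots> \<le> \<phi> u + 1"
      using \<open>finite A\<close> by (simp add: sum.distrib \<phi>_def uv)
    finally show ?thesis .
  qed
  from walk_lipschitz[of wreath_ZZ_adj \<phi>, OF this]
  have "\<phi> (g, y) \<le> \<phi> (f, x) + real k" if "(wreath_ZZ_adj ^^ k) (f, x) (g, y)" for k
    using that by blast
  moreover have "(wreath_ZZ_adj ^^ (LEAST k. (wreath_ZZ_adj ^^ k) (f, x) (g, y))) (f, x) (g, y)"
    by (rule LeastI_ex[OF wreath_ZZ_connected[OF assms(1,2)]])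
  ultimately show ?thesis
    by (fastforce simp: \<phi>_def wreath_ZZ_dist_def path_dist_def)
qed

lemma one_le_wreath_ZZ_dist:
  assumes "u \<in> carrier wreath_ZZ" "v \<in> carrier wreath_ZZ" "u \<noteq> v"
  shows "1 \<le> wreath_ZZ_dist u v"
proof -
  define k where "k = (LEAST k. (wreath_ZZ_adj ^^ k) u v)"
  have "(wreath_ZZ_adj ^^ k) u v"
    unfolding k_def by (rule LeastI_ex[OF wreath_ZZ_connected[OF assms(1,2)]])
  then have "k \<noteq> 0" using assms(3) by (cases k) auto
  then show ?thesis by (simp add: wreath_ZZ_dist_def path_dist_def k_def)
qed

section \<open>A Hilbertian kernel on the wreath product\<close>

text \<open>The increments are at most \<open>k\<^sup>\<beta> ((1 + 1/k) - 1) = k\<^sup>\<beta>\<^sup>-\<^sup>1\<close>, and \<open>2\<beta> - 2 < -1\<close>.\<close>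

lemma summable_powr_increments:
  assumes \<beta>: "0 \<le> \<beta>" "\<beta> < 1 / 2"
  shows "summable (\<lambda>k. (real (Suc k) powr \<beta> - real k powr \<beta>)\<^sup>2)"
proof (rule summable_comparison_test'[where N = 1])
  show "summable (\<lambda>k. real k powr (2 * \<beta> - 2))"
    using \<beta> by (simp add: summable_real_powr_iff)
  fix k :: nat assume k: "k \<ge> 1"
  have "real (Suc k) powr \<beta> = real k powr \<beta> * (1 + 1 / real k) powr \<beta>"
  proof -
    have "real (Suc k) = real k * (1 + 1 / real k)" using k by (simp add: field_simps)
    then show ?thesis by (simp only: powr_mult)
  qed
  also have "(1 + 1 / real k) powr \<beta> \<le> (1 + 1 / real k) powr 1"
    using \<beta> k by (intro powr_mono) auto
  also have "real k powr \<beta> * (1 + 1 / real k) powr 1 = real k powr \<beta> + real k powr (\<beta> - 1)"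
    using k by (simp add: powr_diff field_simps)
  finally have "real (Suc k) powr \<beta> - real k powr \<beta> \<le> real k powr (\<beta> - 1)"
    using k by (simp add: mult_left_mono)
  moreover have "0 \<le> real (Suc k) powr \<beta> - real k powr \<beta>"
    using \<beta> by (simp add: powr_mono2)
  ultimately have "(real (Suc k) powr \<beta> - real k powr \<beta>)\<^sup>2 \<le> (real k powr (\<beta> - 1))\<^sup>2"
    by (rule power_mono)
  also have "\<dots> = real k powr (2 * \<beta> - 2)"
    using k by (simp add: power2_eq_square powr_add[symmetric])
  finally show "norm ((real (Suc k) powr \<beta> - real k powr \<beta>)\<^sup>2) \<le> real k powr (2 * \<beta> - 2)"
    by simp
qed

text \<open>The ramp vanishes on the non-positive integers even for \<open>\<beta> = 0\<close>, since \<open>0 powr 0 = 0\<close>. The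
  exponent \<open>0\<close> occurs, for \<open>p = 1\<close>.\<close>

definition ramp :: "real \<Rightarrow> int \<Rightarrow> real" where
  "ramp \<beta> k = real (nat k) powr \<beta>"

lemma ramp_nonpos [simp]: "k \<le> 0 \<Longrightarrow> ramp \<beta> k = 0"
  by (simp add: ramp_def)

definition ramp_energy :: "real \<Rightarrow> real" where
  "ramp_energy \<beta> = (\<Sum>k. (real (Suc k) powr \<beta> - real k powr \<beta>)\<^sup>2)"

lemma ramp_energy_nonneg: "0 \<le> \<beta> \<Longrightarrow> \<beta> < 1 / 2 \<Longrightarrow> 0 \<le> ramp_energy \<beta>"
  unfolding ramp_energy_def by (intro suminf_nonneg summable_powr_increments) auto

lemma sum_ramp_increments_le:
  assumes \<beta>: "0 \<le> \<beta>" "\<beta> < 1 / 2" and I: "finite I"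
  shows "(\<Sum>z\<in>I. (ramp \<beta> (z - x) - ramp \<beta> (z - (x + 1)))\<^sup>2) \<le> ramp_energy \<beta>"
proof -
  let ?D = "\<lambda>k. (real (Suc k) powr \<beta> - real k powr \<beta>)\<^sup>2"
  let ?J = "{z \<in> I. x < z}"
  have "(\<Sum>z\<in>I. (ramp \<beta> (z - x) - ramp \<beta> (z - (x + 1)))\<^sup>2)
      = (\<Sum>z\<in>?J. (ramp \<beta> (z - x) - ramp \<beta> (z - (x + 1)))\<^sup>2)"
  proof (rule sum.mono_neutral_right)
    show "\<forall>z\<in>I - ?J. (ramp \<beta> (z - x) - ramp \<beta> (z - (x + 1)))\<^sup>2 = 0"
    proof
      fix z assume "z \<in> I - ?J"
      then have "z \<le> x" by auto
      then show "(ramp \<beta> (z - x) - ramp \<beta> (z - (x + 1)))\<^sup>2 = 0" by simp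
    qed
  qed (use I in auto)
  also have "\<dots> = (\<Sum>z\<in>?J. ?D (nat (z - (x + 1))))"
  proof (rule sum.cong[OF refl])
    fix z assume "z \<in> ?J"
    then have "nat (z - x) = Suc (nat (z - (x + 1)))" by auto
    then show "(ramp \<beta> (z - x) - ramp \<beta> (z - (x + 1)))\<^sup>2 = ?D (nat (z - (x + 1)))"
      by (simp only: ramp_def)
  qed
  also have "\<dots> = (\<Sum>k\<in>(\<lambda>z. nat (z - (x + 1))) ` ?J. ?D k)"
    by (subst sum.reindex) (auto simp: inj_on_def)
  also have "\<dots> \<le> ramp_energy \<beta>"
    unfolding ramp_energy_def
    by (rule sum_le_suminf[OF summable_powr_increments[OF \<beta>]]) (use I in auto)
  finally show ?thesis .
qed

definition tail :: "(int \<Rightarrow> int) \<Rightarrow> int \<Rightarrow> int \<Rightarrow> int" where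
  "tail f z u = (if z \<le> u then f u else 0)"

text \<open>The squared distance in Hilbert space between \<open>ramp (z - x) e\<^sub>c\<close> and \<open>ramp (z - y) e\<^sub>d\<close>, where \<open>c\<close> and \<open>d\<close>
  are the configurations of the two points on \<open>[z, \<infinity>)\<close> and the \<open>e\<^sub>c\<close> are orthonormal.\<close>

definition tail_term :: "real \<Rightarrow> int \<Rightarrow> (int \<Rightarrow> int) \<times> int \<Rightarrow> (int \<Rightarrow> int) \<times> int \<Rightarrow> real" where
  "tail_term \<beta> z u v =
    (if tail (fst u) z = tail (fst v) z
     then (ramp \<beta> (z - snd u) - ramp \<beta> (z - snd v))\<^sup>2
     else (ramp \<beta> (z - snd u))\<^sup>2 + (ramp \<beta> (z - snd v))\<^sup>2)"

lemma tail_term_nonneg: "0 \<le> tail_term \<beta> z u v"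
  by (simp add: tail_term_def)

lemma tail_term_commute: "tail_term \<beta> z u v = tail_term \<beta> z v u"
  by (auto simp: tail_term_def power2_commute)

text \<open>A finite chain visits finitely many configurations, so finitely many coordinates suffice.\<close>

lemma tail_term_eq_sum:
  assumes "finite C" "tail (fst u) z \<in> C" "tail (fst v) z \<in> C"
  shows "tail_term \<beta> z u v = (\<Sum>c\<in>C.
    ((if tail (fst u) z = c then ramp \<beta> (z - snd u) else 0)
     - (if tail (fst v) z = c then ramp \<beta> (z - snd v) else 0))\<^sup>2)" (is "_ = ?S")
proof (cases "tail (fst u) z = tail (fst v) z")
  case True
  have "?S = (\<Sum>c\<in>C. if c = tail (fst v) z then (ramp \<beta> (z - snd u) - ramp \<beta> (z - snd v))\<^sup>2 else 0)"
    by (rule sum.cong) (auto simp: True)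
  then show ?thesis using assms True by (simp add: tail_term_def)
next
  case False
  have "?S = (\<Sum>c\<in>C. (if c = tail (fst u) z then (ramp \<beta> (z - snd u))\<^sup>2 else 0)
      + (if c = tail (fst v) z then (ramp \<beta> (z - snd v))\<^sup>2 else 0))"
    by (rule sum.cong) (use False in auto)
  then show ?thesis using assms False by (simp add: tail_term_def sum.distrib)
qed

definition reflect :: "(int \<Rightarrow> int) \<times> int \<Rightarrow> (int \<Rightarrow> int) \<times> int" where
  "reflect u = (\<lambda>z. fst u (- z), - snd u)"

text \<open>The range is controlled to the right by tails and to the left by reflected tails. Restricting
  the places to a finite set \<open>I\<close> keeps all sums finite; every bound below is uniform in \<open>I\<close>, so \<open>I\<close> may
  depend on the chain.\<close>

definition kernel :: "real \<Rightarrow> int set \<Rightarrow> (int \<Rightarrow> int) \<times> int \<Rightarrow> (int \<Rightarrow> int) \<times> int \<Rightarrow> real" where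
  "kernel \<beta> I u v = (real_of_int (snd u) - real_of_int (snd v))\<^sup>2
    + (\<Sum>z\<in>I. (real_of_int (fst u z) - real_of_int (fst v z))\<^sup>2)
    + (\<Sum>z\<in>I. tail_term \<beta> z u v) + (\<Sum>z\<in>I. tail_term \<beta> z (reflect u) (reflect v))"

lemma (in reversible_stationary_chain) linear_growth_kernel:
  fixes F :: "nat \<Rightarrow> (int \<Rightarrow> int) \<times> int"
  shows "linear_growth (\<lambda>i j. kernel \<beta> I (F i) (F j))"
proof -
  have tail: "linear_growth (\<lambda>i j. tail_term \<beta> z (G i) (G j))" for z and G :: "nat \<Rightarrow> (int \<Rightarrow> int) \<times> int"
  proof -
    let ?C = "(\<lambda>i. tail (fst (G i)) z) ` {1..n}"
    let ?h = "\<lambda>c i. if tail (fst (G i)) z = c then ramp \<beta> (z - snd (G i)) else 0"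
    have "linear_growth (\<lambda>i j. \<Sum>c\<in>?C. (?h c i - ?h c j)\<^sup>2)"
      by (rule linear_growth_sum, rule linear_growth_sq_dist)
    then show ?thesis
      by (rule linear_growth_cong) (rule tail_term_eq_sum, auto)
  qed
  show ?thesis
    unfolding kernel_def
    by (intro linear_growth_add linear_growth_sum linear_growth_sq_dist tail)
qed

text \<open>Unlike the adjacency relation this does not mention generators, and it is visibly invariant
  under reflection.\<close>

definition neighbours :: "(int \<Rightarrow> int) \<times> int \<Rightarrow> (int \<Rightarrow> int) \<times> int \<Rightarrow> bool" where
  "neighbours u v \<longleftrightarrow> fst u = fst v \<and> \<bar>snd u - snd v\<bar> = 1 \<or>
    snd u = snd v \<and> \<bar>fst u (snd u) - fst v (snd u)\<bar> = 1 \<and> (\<forall>z. z \<noteq> snd u \<longrightarrow> fst u z = fst v z)"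

lemma neighbours_reflect: "neighbours u v \<Longrightarrow> neighbours (reflect u) (reflect v)"
  by (auto simp: neighbours_def reflect_def fun_eq_iff)

text \<open>A step to the side changes only the weights, by an increment of the ramp at each place. A
  switch at \<open>x\<close> alters only the tails that start at some \<open>z \<le> x\<close>, and those carry weight \<open>0\<close>.\<close>

lemma tail_term_neighbours_le:
  assumes \<beta>: "0 \<le> \<beta>" "\<beta> < 1 / 2" and I: "finite I" and uv: "neighbours u v"
  shows "(\<Sum>z\<in>I. tail_term \<beta> z u v) \<le> ramp_energy \<beta>"
proof -
  have move: "(\<Sum>z\<in>I. tail_term \<beta> z u v) \<le> ramp_energy \<beta>"
    if "fst u = fst v" "snd v = snd u + 1" for u v
    using sum_ramp_increments_le[OF \<beta> I, of "snd u"] that by (simp add: tail_term_def)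
  from uv consider "fst u = fst v" "snd v = snd u + 1" | "fst v = fst u" "snd u = snd v + 1"
    | "snd u = snd v" "\<And>z. z \<noteq> snd u \<Longrightarrow> fst u z = fst v z"
    unfolding neighbours_def by force
  then show ?thesis
  proof cases
    case 1
    then show ?thesis by (rule move)
  next
    case 2
    then show ?thesis using move[of v u] by (simp add: tail_term_commute)
  next
    case 3
    have "tail_term \<beta> z u v = 0" for z
    proof (cases "z \<le> snd u")
      case True
      then show ?thesis using 3 by (simp add: tail_term_def)
    next
      case False
      then have "tail (fst u) z = tail (fst v) z" using 3 by (auto simp: tail_def fun_eq_iff)
      then show ?thesis using 3 by (simp add: tail_term_def)
    qed
    then show ?thesis using ramp_energy_nonneg[OF \<beta>] by simp
  qed
qed

lemma kernel_neighbours_le: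
  assumes \<beta>: "0 \<le> \<beta>" "\<beta> < 1 / 2" and I: "finite I" and uv: "neighbours u v"
  shows "kernel \<beta> I u v \<le> 2 + 2 * ramp_energy \<beta>"
proof -
  have "(real_of_int (snd u) - real_of_int (snd v))\<^sup>2 \<le> 1"
    using uv unfolding neighbours_def abs_square_le_1 by auto
  moreover have "(\<Sum>z\<in>I. (real_of_int (fst u z) - real_of_int (fst v z))\<^sup>2) \<le> (\<Sum>z\<in>I. if z = snd u then 1 else 0)"
  proof (rule sum_mono)
    fix z
    have "z \<noteq> snd u \<Longrightarrow> fst u z = fst v z" "\<bar>fst u (snd u) - fst v (snd u)\<bar> \<le> 1"
      using uv unfolding neighbours_def by auto
    then show "(real_of_int (fst u z) - real_of_int (fst v z))\<^sup>2 \<le> (if z = snd u then 1 else 0)"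
      by (auto simp: abs_square_le_1)
  qed
  then have "(\<Sum>z\<in>I. (real_of_int (fst u z) - real_of_int (fst v z))\<^sup>2) \<le> 1"
    using I by (auto split: if_splits intro: order_trans)
  ultimately show ?thesis
    using tail_term_neighbours_le[OF \<beta> I uv] tail_term_neighbours_le[OF \<beta> I neighbours_reflect[OF uv]]
    unfolding kernel_def by linarith
qed

text \<open>As \<open>2\<beta> - 1 < 0\<close>, each summand \<open>k\<^sup>2\<^sup>\<beta>\<close> is at least \<open>r\<^sup>2\<^sup>\<beta>\<^sup>-\<^sup>1 k\<close>, and \<open>1 + \<dots> + r \<ge> r\<^sup>2 / 2\<close>.\<close>

lemma powr_le_sum_powr:
  assumes \<beta>: "0 \<le> \<beta>" "\<beta> < 1 / 2"
  shows "real r powr (2 * \<beta> + 1) \<le> 2 * (\<Sum>k=1..r. real k powr (2 * \<beta>))"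
proof (cases "r = 0")
  case False
  have "real r powr (2 * \<beta> - 1) * real k \<le> real k powr (2 * \<beta>)" if "k \<in> {1..r}" for k
  proof -
    have "real r powr (2 * \<beta> - 1) \<le> real k powr (2 * \<beta> - 1)"
      using that \<beta> by (intro powr_mono2') auto
    then have "real r powr (2 * \<beta> - 1) * real k \<le> real k powr (2 * \<beta> - 1) * real k"
      by (rule mult_right_mono) simp
    also have "\<dots> = real k powr (2 * \<beta>)" using that by (simp add: powr_diff)
    finally show ?thesis .
  qed
  then have "real r powr (2 * \<beta> - 1) * (\<Sum>k=1..r. real k) \<le> (\<Sum>k=1..r. real k powr (2 * \<beta>))"
    unfolding sum_distrib_left by (rule sum_mono)
  moreover have "(\<Sum>k=1..r. real k) = real r * (real r + 1) / 2"
    by (induction r) (auto simp: field_simps)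
  ultimately have "real r powr (2 * \<beta> - 1) * (real r * (real r + 1)) \<le> 2 * (\<Sum>k=1..r. real k powr (2 * \<beta>))"
    by (simp only: times_divide_eq_right)
  moreover have "real r powr (2 * \<beta> + 1) = real r powr (2 * \<beta> - 1) * (real r * real r)"
    using False by (simp add: powr_diff powr_add)
  moreover have "\<dots> \<le> real r powr (2 * \<beta> - 1) * (real r * (real r + 1))"
    by (intro mult_left_mono) auto
  ultimately show ?thesis by linarith
qed simp

text \<open>All tails that start between the position and \<open>z0\<close> contain the disagreement at \<open>z0\<close>, so each of
  these places contributes its full weight.\<close>

lemma tail_term_range_ge:
  assumes \<beta>: "0 \<le> \<beta>" "\<beta> < 1 / 2" and I: "finite I" "{snd u<..z0} \<subseteq> I"
    and z0: "fst u z0 \<noteq> fst v z0" "snd u \<le> z0"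
  shows "real_of_int (z0 - snd u) powr (2 * \<beta> + 1) \<le> 2 * (\<Sum>z\<in>I. tail_term \<beta> z u v)"
proof -
  define r where "r = nat (z0 - snd u)"
  have "real_of_int (z0 - snd u) powr (2 * \<beta> + 1) \<le> 2 * (\<Sum>k=1..r. real k powr (2 * \<beta>))"
    using powr_le_sum_powr[OF \<beta>, of r] z0(2) by (simp add: r_def)
  also have "(\<Sum>k=1..r. real k powr (2 * \<beta>)) = (\<Sum>z\<in>{snd u<..z0}. (ramp \<beta> (z - snd u))\<^sup>2)"
  proof (rule sum.reindex_bij_witness[where i = "\<lambda>z. nat (z - snd u)" and j = "\<lambda>k. snd u + int k"])
    fix k assume "k \<in> {1..r}"
    then show "(ramp \<beta> (snd u + int k - snd u))\<^sup>2 = real k powr (2 * \<beta>)"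
      by (simp add: ramp_def power2_eq_square powr_add[symmetric])
  qed (auto simp: r_def)
  also have "\<dots> \<le> (\<Sum>z\<in>{snd u<..z0}. tail_term \<beta> z u v)"
  proof (rule sum_mono)
    fix z assume "z \<in> {snd u<..z0}"
    then have "tail (fst u) z z0 \<noteq> tail (fst v) z z0" using z0 by (simp add: tail_def)
    then have "tail (fst u) z \<noteq> tail (fst v) z" by auto
    then show "(ramp \<beta> (z - snd u))\<^sup>2 \<le> tail_term \<beta> z u v" by (simp add: tail_term_def)
  qed
  also have "\<dots> \<le> (\<Sum>z\<in>I. tail_term \<beta> z u v)"
    by (rule sum_mono2[OF I]) (rule tail_term_nonneg)
  finally show ?thesis by simp
qed

lemma powr_sum3_le:
  fixes a b c p :: real
  assumes "0 \<le> a" "0 \<le> b" "0 \<le> c" "0 \<le> p" "p \<le> 2"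
  shows "(a + b + c) powr p \<le> 9 * (a powr p + b powr p + c powr p)"
proof -
  define m where "m = max a (max b c)"
  have "(a + b + c) powr p \<le> (3 * m) powr p"
    using assms by (intro powr_mono2) (auto simp: m_def)
  also have "\<dots> = 3 powr p * m powr p" by (simp add: powr_mult)
  also have "\<dots> \<le> 3 powr 2 * m powr p"
    using assms by (intro mult_right_mono powr_mono) auto
  also have "m powr p \<le> a powr p + b powr p + c powr p"
    using assms by (auto simp: m_def max_def)
  finally show ?thesis by simp
qed

lemma powr_le_square:
  fixes m :: int
  assumes "p \<le> 2"
  shows "\<bar>real_of_int m\<bar> powr p \<le> (real_of_int m)\<^sup>2"
proof (cases "m = 0")
  case False
  then have "1 \<le> \<bar>real_of_int m\<bar>" by linarith
  then have "\<bar>real_of_int m\<bar> powr p \<le> \<bar>real_of_int m\<bar> powr 2"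
    using assms by (rule powr_mono[rotated])
  then show ?thesis using False by simp
qed simp

lemma range_powr_le:
  fixes r p s :: real
  assumes p: "1 \<le> p" "p < 4 / 3" and s: "s = p / (2 - p)" and r: "r = 0 \<or> 1 \<le> r"
  shows "r powr p \<le> r powr s"
proof -
  have "p \<le> s" using p by (auto simp: s field_simps)
  then show ?thesis using r by (auto intro: powr_mono)
qed

text \<open>Put \<open>q = p / 2\<close>, so that \<open>q / s = 1 - q\<close>, and let \<open>T\<close> be the maximum of \<open>S\<close> and \<open>(2r + 1)\<^sup>s\<close>. Then
  \<open>D\<^sup>p \<le> (2r + 1)\<^sup>q S\<^sup>q \<le> T\<^sup>1\<^sup>-\<^sup>q T\<^sup>q = T\<close>. This balance is what fixes the value of \<open>s\<close>.\<close>

lemma lamps_powr_le: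
  fixes r D S p s :: real
  assumes p: "1 \<le> p" "p < 4 / 3" and s: "s = p / (2 - p)"
    and r: "r = 0 \<or> 1 \<le> r" and D: "0 \<le> D" "D\<^sup>2 \<le> (2 * r + 1) * S" and S: "1 \<le> S"
  shows "D powr p \<le> 2 * S + 9 * r powr s"
proof -
  have s1: "p \<le> s" "s \<le> 2" using p by (auto simp: s field_simps)
  have r0: "0 \<le> r" using r by auto
  define T where "T = max S ((2 * r + 1) powr s)"
  have T: "1 \<le> T" using S by (simp add: T_def)
  have "D powr p = (D\<^sup>2) powr (p / 2)"
  proof -
    have "D\<^sup>2 = D powr 2" if "D \<noteq> 0" using D that by simp
    then show ?thesis by (cases "D = 0") (simp_all add: powr_powr)
  qed
  also have "\<dots> \<le> ((2 * r + 1) * S) powr (p / 2)"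
    using D p by (intro powr_mono2) auto
  also have "\<dots> = (2 * r + 1) powr (p / 2) * S powr (p / 2)"
    using r0 S by (simp add: powr_mult)
  also have "(2 * r + 1) powr (p / 2) = ((2 * r + 1) powr s) powr (1 - p / 2)"
  proof -
    have "s * (1 - p / 2) = p / 2" using p by (simp add: s field_simps)
    then show ?thesis by (simp only: powr_powr)
  qed
  also have "\<dots> * S powr (p / 2) \<le> T powr (1 - p / 2) * T powr (p / 2)"
    using p S by (intro mult_mono powr_mono2) (auto simp: T_def)
  also have "\<dots> = T" using T by (simp flip: powr_add)
  also have "T \<le> S + (2 * r + 1) powr s" using S by (simp add: T_def)
  also have "(2 * r + 1) powr s \<le> 9 * r powr s + 1"
    using r
  proof
    assume "1 \<le> r"
    then have "(2 * r + 1) powr s \<le> (3 * r) powr s"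
      using s1 p by (intro powr_mono2) auto
    also have "\<dots> \<le> 3 powr 2 * r powr s"
      using s1 by (simp only: powr_mult) (intro mult_right_mono powr_mono, auto)
    finally show ?thesis by simp
  qed simp
  finally show "D powr p \<le> 2 * S + 9 * r powr s" using S by simp
qed

text \<open>The exponent \<open>\<beta> = (p - 1) / (2 - p)\<close> solves \<open>2\<beta> + 1 = p / (2 - p)\<close>. The constant arises from
  \<open>d \<le> 4r + \<bar>x - y\<bar> + 3D\<close>: exponents up to \<open>2\<close> give \<open>9 (16 r\<^sup>p + \<bar>x - y\<bar>\<^sup>p + 9 D\<^sup>p)\<close>, in which \<open>r\<^sup>s\<close> appears \<open>97\<close>
  times and costs twice the tail terms, and \<open>9 \<cdot> 97 \<cdot> 2 = 1746\<close>.\<close>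

lemma wreath_ZZ_dist_powr_le_kernel:
  assumes p: "1 \<le> p" "p < 4 / 3"
    and u: "u \<in> carrier wreath_ZZ" "\<bar>snd u\<bar> \<le> N" "\<And>z. fst u z \<noteq> 0 \<Longrightarrow> \<bar>z\<bar> \<le> N"
    and v: "v \<in> carrier wreath_ZZ" "\<And>z. fst v z \<noteq> 0 \<Longrightarrow> \<bar>z\<bar> \<le> N"
  shows "wreath_ZZ_dist u v powr p \<le> 1746 * kernel ((p - 1) / (2 - p)) {- N..N} u v"
proof -
  define f x g y where "f = fst u" and "x = snd u" and "g = fst v" and "y = snd v"
  have uv: "u = (f, x)" "v = (g, y)" by (simp_all add: f_def x_def g_def y_def)
  have fin: "finite {z. f z \<noteq> 0}" "finite {z. g z \<noteq> 0}"
    using u(1) v(1) by (simp_all add: uv wreath_ZZ_def)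
  define \<beta> where "\<beta> = (p - 1) / (2 - p)"
  define s where "s = p / (2 - p)"
  have \<beta>: "0 \<le> \<beta>" "\<beta> < 1 / 2" using p by (auto simp: \<beta>_def field_simps)
  have s\<beta>: "2 * \<beta> + 1 = s" using p by (simp add: \<beta>_def s_def field_simps)
  define X where "X = (real_of_int x - real_of_int y)\<^sup>2"
  define S where "S = (\<Sum>z\<in>{- N..N}. (real_of_int (f z) - real_of_int (g z))\<^sup>2)"
  define Tp where "Tp = (\<Sum>z\<in>{- N..N}. tail_term \<beta> z u v)"
  define Tm where "Tm = (\<Sum>z\<in>{- N..N}. tail_term \<beta> z (reflect u) (reflect v))"
  have kernel: "kernel \<beta> {- N..N} u v = X + S + Tp + Tm"
    by (simp add: kernel_def X_def S_def Tp_def Tm_def uv)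
  have nonneg: "0 \<le> X" "0 \<le> S" "0 \<le> Tp" "0 \<le> Tm"
    by (simp_all add: X_def S_def Tp_def Tm_def sum_nonneg tail_term_nonneg)
  have xy: "\<bar>real_of_int (x - y)\<bar> powr p \<le> X"
    using powr_le_square[of p "x - y"] p by (simp add: X_def)
  have dist0: "0 \<le> wreath_ZZ_dist u v" by (simp add: wreath_ZZ_dist_def path_dist_def)
  have "wreath_ZZ_dist u v powr p \<le> 1746 * (X + S + Tp + Tm)"
  proof (cases "f = g")
    case True
    have "wreath_ZZ_dist u v powr p \<le> \<bar>real_of_int (x - y)\<bar> powr p"
      using wreath_ZZ_dist_move[OF fin(1), of x y] p dist0 True by (intro powr_mono2) (auto simp: uv)
    then have "wreath_ZZ_dist u v powr p \<le> X" using xy by (rule order_trans)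
    also have "X \<le> 1746 * (X + S + Tp + Tm)" using nonneg by simp
    finally show ?thesis .
  next
    case False
    define A where "A = {z. f z \<noteq> g z}"
    have A: "finite A" "A \<noteq> {}"
      unfolding A_def using False by (auto intro: finite_subset[OF _ finite_UnI[OF fin]])
    have AN: "\<bar>z\<bar> \<le> N" if "z \<in> A" for z
      using that u(3)[of z] v(2)[of z] by (force simp: A_def uv)
    define m where "m = Max ((\<lambda>z. \<bar>z - x\<bar>) ` A)"
    have "m \<in> (\<lambda>z. \<bar>z - x\<bar>) ` A" unfolding m_def by (rule Max_in) (use A in auto)
    then obtain z0 where z0: "z0 \<in> A" "m = \<bar>z0 - x\<bar>" by blast
    define r where "r = nat m"
    have mr: "m = int r" using z0 by (simp add: r_def)
    have supp: "\<bar>z - x\<bar> \<le> int r" if "f z \<noteq> g z" for z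
      unfolding mr[symmetric] m_def using A that by (auto simp: A_def)
    let ?J = "{x - int r..x + int r}"
    define D where "D = (\<Sum>z\<in>?J. \<bar>real_of_int (f z - g z)\<bar>)"
    have z0J: "z0 \<in> ?J" using z0 mr by auto
    have z0I: "z0 \<in> {- N..N}" using AN[OF z0(1)] by auto
    have int1: "1 \<le> \<bar>real_of_int (f z0 - g z0)\<bar>" using z0(1) unfolding A_def by simp
    have D1: "1 \<le> D"
      using int1 member_le_sum[OF z0J, of "\<lambda>z. \<bar>real_of_int (f z - g z)\<bar>"] by (simp add: D_def)
    have S1: "1 \<le> S"
    proof -
      have "1 \<le> (real_of_int (f z0) - real_of_int (g z0))\<^sup>2"
        using int1 abs_le_square_iff[of 1 "real_of_int (f z0 - g z0)"] by simp
      also have "\<dots> \<le> S"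
        unfolding S_def using member_le_sum[OF z0I, of "\<lambda>z. (real_of_int (f z) - real_of_int (g z))\<^sup>2"] by simp
      finally show ?thesis .
    qed
    have DS: "D\<^sup>2 \<le> (2 * real r + 1) * S"
    proof -
      have "D\<^sup>2 \<le> (\<Sum>z\<in>?J. \<bar>real_of_int (f z - g z)\<bar>\<^sup>2) * (\<Sum>z\<in>?J. 1\<^sup>2)"
        using Cauchy_Schwarz_ineq_sum[of "\<lambda>z. \<bar>real_of_int (f z - g z)\<bar>" "\<lambda>z. 1" ?J] by (simp add: D_def)
      also have "(\<Sum>z\<in>?J. 1\<^sup>2) = 2 * real r + 1" by simp
      also have "(\<Sum>z\<in>?J. \<bar>real_of_int (f z - g z)\<bar>\<^sup>2) = (\<Sum>z\<in>A. (real_of_int (f z) - real_of_int (g z))\<^sup>2)"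
        by (rule sum.mono_neutral_cong_right) (use supp in \<open>force simp: A_def\<close>)+
      also have "\<dots> \<le> S"
        unfolding S_def
      proof (rule sum_mono2)
        show "A \<subseteq> {- N..N}"
        proof
          fix z assume "z \<in> A"
          then show "z \<in> {- N..N}" using AN[of z] by auto
        qed
      qed auto
      finally show ?thesis by (simp add: mult.commute mult_left_mono)
    qed
    have range: "real r powr s \<le> 2 * (Tp + Tm)"
    proof (cases "x \<le> z0")
      case True
      then have r: "real r = real_of_int (z0 - snd u)" and z0': "fst u z0 \<noteq> fst v z0" "snd u \<le> z0"
        using z0 mr by (simp_all add: uv A_def)
      have "{snd u<..z0} \<subseteq> {- N..N}" using u(2) z0I by auto
      then have "real r powr s \<le> 2 * Tp"
        unfolding r Tp_def s\<beta>[symmetric] by (intro tail_term_range_ge[OF \<beta>] z0') auto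
      then show ?thesis using nonneg by simp
    next
      case False
      then have r: "real r = real_of_int (- z0 - snd (reflect u))"
        and z0': "fst (reflect u) (- z0) \<noteq> fst (reflect v) (- z0)" "snd (reflect u) \<le> - z0"
        using z0 mr by (simp_all add: uv A_def reflect_def)
      have "{snd (reflect u)<..- z0} \<subseteq> {- N..N}"
        using u(2) z0I unfolding reflect_def by auto
      then have "real r powr s \<le> 2 * Tm"
        unfolding r Tm_def s\<beta>[symmetric] by (intro tail_term_range_ge[OF \<beta>] z0') auto
      then show ?thesis using nonneg by simp
    qed
    have r: "real r = 0 \<or> 1 \<le> real r" by auto
    note powr = range_powr_le[OF p s_def r] lamps_powr_le[OF p s_def r _ DS S1]
    \<comment> \<open>the additive \<open>2\<close> of the walk is absorbed by \<open>2 * D\<close>, since some lamp differs\<close>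
    have "wreath_ZZ_dist u v \<le> 4 * real r + \<bar>real_of_int (x - y)\<bar> + 3 * D"
      using wreath_ZZ_dist_le[OF fin supp, of y] D1 unfolding uv D_def by linarith
    then have "wreath_ZZ_dist u v powr p \<le> (4 * real r + \<bar>real_of_int (x - y)\<bar> + 3 * D) powr p"
      using p dist0 by (intro powr_mono2) auto
    also have "\<dots> \<le> 9 * ((4 * real r) powr p + \<bar>real_of_int (x - y)\<bar> powr p + (3 * D) powr p)"
      using p D1 by (intro powr_sum3_le) auto
    also have "(4 * real r) powr p \<le> 4 powr 2 * real r powr p"
      using p by (simp only: powr_mult) (intro mult_right_mono powr_mono, auto)
    also have "(3 * D) powr p \<le> 3 powr 2 * D powr p"
      using p by (simp only: powr_mult) (intro mult_right_mono powr_mono, auto)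
    finally have "wreath_ZZ_dist u v powr p
        \<le> 9 * (16 * real r powr p + \<bar>real_of_int (x - y)\<bar> powr p + 9 * D powr p)"
      by simp
    then show ?thesis
      using powr D1 xy range nonneg by (smt (verit))
  qed
  then show ?thesis unfolding kernel[symmetric] \<beta>_def .
qed

section \<open>Edge Markov type\<close>

lemma neighbours_of_adj: "wreath_ZZ_adj v u \<Longrightarrow> neighbours u v"
  using wreath_ZZ_adj_cases[of "fst v" "snd v" "fst u" "snd u"] by (auto simp: neighbours_def)

lemma edge_markov_type_wreath_ZZ:
  assumes p: "1 \<le> p" "p < 4 / 3"
  shows "edge_markov_type (carrier wreath_ZZ) wreath_ZZ_adj p"
proof -
  define \<beta> where "\<beta> = (p - 1) / (2 - p)"
  have \<beta>: "0 \<le> \<beta>" "\<beta> < 1 / 2" using p by (auto simp: \<beta>_def field_simps)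
  define C where "C = 1746 * (2 + 2 * ramp_energy \<beta>)"
  have C: "0 < C" using ramp_energy_nonneg[OF \<beta>] by (simp add: C_def)
  define K where "K = C powr (1 / p)"
  have K: "K > 0" "K powr p = C" using C p by (simp_all add: K_def powr_powr)
  have "edge_markov_type_const (carrier wreath_ZZ) wreath_ZZ_adj p K"
    unfolding edge_markov_type_const_def wreath_ZZ_dist_def[symmetric]
  proof (intro allI impI, elim conjE)
    fix n a t and M :: "(nat \<Rightarrow> nat) measure" and Z and F :: "nat \<Rightarrow> (int \<Rightarrow> int) \<times> int"
    assume chain: "markov_chain M n a Z" "stationary_chain M n Z" "reversible_chain M n a Z"
      and F: "F \<in> {1..n} \<rightarrow> carrier wreath_ZZ"
      and edge: "\<forall>\<omega>\<in>space M. wreath_ZZ_adj (F (Z 0 \<omega>)) (F (Z 1 \<omega>))"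
    interpret reversible_stationary_chain M n a Z
      using chain by unfold_locales
    have FZ: "F (Z t \<omega>) \<in> carrier wreath_ZZ" if "\<omega> \<in> space M" for t \<omega>
      using F Z_in_states[OF that] by blast
    define U where "U = (\<Union>i\<in>{1..n}. insert (snd (F i)) {z. fst (F i) z \<noteq> 0})"
    have U: "snd (F i) \<in> U" "fst (F i) z \<noteq> 0 \<Longrightarrow> z \<in> U" if "i \<in> {1..n}" for i z
      using that by (auto simp: U_def)
    define N where "N = (\<Sum>z\<in>U. \<bar>z\<bar>)"
    have "finite {z. fst (F i) z \<noteq> 0}" if "i \<in> {1..n}" for i
    proof -
      have "F i \<in> carrier wreath_ZZ" using F that by blast
      then show ?thesis by (cases "F i") (simp add: wreath_ZZ_def)
    qed
    then have "finite U" unfolding U_def by simp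
    then have N: "\<bar>z\<bar> \<le> N" if "z \<in> U" for z
      unfolding N_def using member_le_sum[OF that, of "\<lambda>z. \<bar>z\<bar>"] by simp
    define Q where "Q i j = kernel \<beta> {- N..N} (F i) (F j)" for i j
    have dist: "wreath_ZZ_dist (F (Z t \<omega>)) (F (Z 0 \<omega>)) powr p \<le> 1746 * Q (Z t \<omega>) (Z 0 \<omega>)"
      if "\<omega> \<in> space M" for \<omega>
      unfolding Q_def \<beta>_def
      by (rule wreath_ZZ_dist_powr_le_kernel[OF p])
        (use FZ[OF that] N U Z_in_states[OF that] in blast)+
    have "expectation (\<lambda>\<omega>. wreath_ZZ_dist (F (Z t \<omega>)) (F (Z 0 \<omega>)) powr p)
        \<le> expectation (\<lambda>\<omega>. 1746 * Q (Z t \<omega>) (Z 0 \<omega>))"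
      using integrable_states[of "\<lambda>i j. wreath_ZZ_dist (F i) (F j) powr p" t 0]
        integrable_states[of "\<lambda>i j. 1746 * Q i j" t 0] dist
      by (rule integral_mono)
    also have "\<dots> \<le> 1746 * (real t * expectation (\<lambda>\<omega>. Q (Z 1 \<omega>) (Z 0 \<omega>)))"
      using linear_growth_kernel[of \<beta> "{- N..N}" F] unfolding linear_growth_def Q_def by simp
    also have "\<dots> \<le> 1746 * (real t * (2 + 2 * ramp_energy \<beta>))"
    proof (intro mult_left_mono integral_le_const[OF integrable_states])
      show "AE \<omega> in M. Q (Z 1 \<omega>) (Z 0 \<omega>) \<le> 2 + 2 * ramp_energy \<beta>"
        unfolding Q_def using edge by (auto intro!: kernel_neighbours_le[OF \<beta>] neighbours_of_adj)
    qed simp_all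
    finally have upper: "expectation (\<lambda>\<omega>. wreath_ZZ_dist (F (Z t \<omega>)) (F (Z 0 \<omega>)) powr p) \<le> C * real t"
      by (simp add: C_def mult_ac)
    have "1 \<le> wreath_ZZ_dist (F (Z 1 \<omega>)) (F (Z 0 \<omega>)) powr p" if "\<omega> \<in> space M" for \<omega>
    proof -
      have "neighbours (F (Z 1 \<omega>)) (F (Z 0 \<omega>))" using edge that by (auto intro: neighbours_of_adj)
      then have "F (Z 1 \<omega>) \<noteq> F (Z 0 \<omega>)" unfolding neighbours_def by auto
      from one_le_wreath_ZZ_dist[OF FZ[OF that] FZ[OF that] this]
      show ?thesis using p by (intro ge_one_powr_ge_zero) auto
    qed
    then have lower: "1 \<le> expectation (\<lambda>\<omega>. wreath_ZZ_dist (F (Z 1 \<omega>)) (F (Z 0 \<omega>)) powr p)"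
      by (intro integral_ge_const integrable_states[of "\<lambda>i j. wreath_ZZ_dist (F i) (F j) powr p"]) auto
    have "C * real t * 1 \<le> C * real t * expectation (\<lambda>\<omega>. wreath_ZZ_dist (F (Z 1 \<omega>)) (F (Z 0 \<omega>)) powr p)"
      by (rule mult_left_mono[OF lower]) (use C in simp)
    with upper show "expectation (\<lambda>\<omega>. wreath_ZZ_dist (F (Z t \<omega>)) (F (Z 0 \<omega>)) powr p)
        \<le> K powr p * real t * expectation (\<lambda>\<omega>. wreath_ZZ_dist (F (Z 1 \<omega>)) (F (Z 0 \<omega>)) powr p)"
      by (simp add: K(2))
  qed
  then show ?thesis unfolding edge_markov_type_def using K(1) by blast
qed

section \<open>Failure of Enflo type\<close>

lemma finite_sign_cube: "finite (sign_cube n)"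
  unfolding sign_cube_def by (intro finite_PiE) auto

lemma sign_cube_nonempty: "sign_cube n \<noteq> {}"
  by (auto simp: sign_cube_def PiE_eq_empty_iff)

lemma expectation_sign_cube_ge:
  fixes h :: "(nat \<Rightarrow> int) \<Rightarrow> real"
  assumes "\<And>\<epsilon>. \<epsilon> \<in> sign_cube n \<Longrightarrow> b \<le> h \<epsilon>"
  shows "b \<le> measure_pmf.expectation (pmf_of_set (sign_cube n)) h"
proof -
  have "card (sign_cube n) > 0" using finite_sign_cube sign_cube_nonempty by (simp add: card_gt_0_iff)
  then show ?thesis
    using sum_bounded_below[of "sign_cube n" b h] assms
    by (simp add: integral_pmf_of_set[OF sign_cube_nonempty finite_sign_cube] field_simps)
qed

lemma expectation_sign_cube_le:
  fixes h :: "(nat \<Rightarrow> int) \<Rightarrow> real"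
  assumes "\<And>\<epsilon>. \<epsilon> \<in> sign_cube n \<Longrightarrow> h \<epsilon> \<le> b"
  shows "measure_pmf.expectation (pmf_of_set (sign_cube n)) h \<le> b"
  using expectation_sign_cube_ge[of n "- b" "\<lambda>\<epsilon>. - h \<epsilon>"] assms by simp

text \<open>The factor \<open>n\<close> makes writing one lamp as expensive as walking to it. With a smaller factor the
  walk would dominate the cost of a flip; the factor \<open>1\<close> gives only antipodes of order \<open>n\<close>.\<close>

definition cube_embedding :: "nat \<Rightarrow> (nat \<Rightarrow> int) \<Rightarrow> (int \<Rightarrow> int) \<times> int" where
  "cube_embedding n \<epsilon> = (\<lambda>z. if z \<in> {1..int n} then int n * \<epsilon> (nat z) else 0, 0)"

lemma cube_embedding_carrier: "cube_embedding n \<epsilon> \<in> carrier wreath_ZZ"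
proof -
  have "finite {z. (if z \<in> {1..int n} then int n * \<epsilon> (nat z) else 0) \<noteq> 0}"
    by (rule finite_subset[of _ "{1..int n}"]) auto
  then show ?thesis by (simp add: cube_embedding_def wreath_ZZ_def)
qed

lemma cube_embedding_antipode:
  assumes "\<epsilon> \<in> sign_cube n"
  shows "2 * real n ^ 2 \<le> wreath_ZZ_dist (cube_embedding n \<epsilon>) (cube_embedding n (cube_neg n \<epsilon>))"
proof -
  have sign: "\<bar>\<epsilon> i\<bar> = 1" if "i \<in> {1..n}" for i
    using assms that by (force simp: sign_cube_def PiE_def Pi_def)
  have "(\<Sum>z\<in>{1..int n}. \<bar>real_of_int (fst (cube_embedding n \<epsilon>) z - fst (cube_embedding n (cube_neg n \<epsilon>)) z)\<bar>)
      = (\<Sum>z\<in>{1..int n}. 2 * real n)"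
  proof (rule sum.cong[OF refl])
    fix z assume z: "z \<in> {1..int n}"
    then have i: "nat z \<in> {1..n}" by auto
    have "\<bar>real_of_int (\<epsilon> (nat z))\<bar> = 1" using sign[OF i] by linarith
    then show "\<bar>real_of_int (fst (cube_embedding n \<epsilon>) z - fst (cube_embedding n (cube_neg n \<epsilon>)) z)\<bar> = 2 * real n"
      using z i by (simp add: cube_embedding_def cube_neg_def abs_mult flip: mult_2)
  qed
  also have "\<dots> = 2 * real n ^ 2" by (simp add: power2_eq_square)
  finally show ?thesis
    using wreath_ZZ_dist_ge[of "fst (cube_embedding n \<epsilon>)" 0 "fst (cube_embedding n (cube_neg n \<epsilon>))" 0 "{1..int n}"]
      cube_embedding_carrier[of n] by (simp add: cube_embedding_def)
qed

lemma cube_embedding_flip: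
  assumes \<epsilon>: "\<epsilon> \<in> sign_cube n" and j: "j \<in> {1..n}"
  shows "wreath_ZZ_dist (cube_embedding n \<epsilon>) (cube_embedding n (\<epsilon>(j := - \<epsilon> j))) \<le> 8 * real n"
proof -
  define f where "f = fst (cube_embedding n \<epsilon>)"
  define g where "g = fst (cube_embedding n (\<epsilon>(j := - \<epsilon> j)))"
  have eq: "cube_embedding n \<epsilon> = (f, 0)" "cube_embedding n (\<epsilon>(j := - \<epsilon> j)) = (g, 0)"
    by (simp_all add: f_def g_def cube_embedding_def)
  have fin: "finite {z. f z \<noteq> 0}" "finite {z. g z \<noteq> 0}"
    using cube_embedding_carrier[of n \<epsilon>] cube_embedding_carrier[of n "\<epsilon>(j := - \<epsilon> j)"]
    by (simp_all add: eq wreath_ZZ_def)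
  have sign: "\<bar>\<epsilon> j\<bar> = 1"
    using \<epsilon> j by (force simp: sign_cube_def PiE_def Pi_def)
  have same: "f z = g z" if "z \<noteq> int j" for z
    using that by (auto simp: f_def g_def cube_embedding_def)
  have "wreath_ZZ_dist (f, 0) (g, 0) \<le> 4 * real j + 2 + \<bar>real_of_int (0 - 0)\<bar>
    + (\<Sum>z\<in>{0 - int j..0 + int j}. \<bar>real_of_int (f z - g z)\<bar>)"
    by (rule wreath_ZZ_dist_le[OF fin]) (use same in force)
  also have "(\<Sum>z\<in>{0 - int j..0 + int j}. \<bar>real_of_int (f z - g z)\<bar>)
      = (\<Sum>z\<in>{0 - int j..0 + int j}. if z = int j then 2 * real n else 0)"
  proof (rule sum.cong[OF refl])
    fix z
    have "\<bar>real_of_int (\<epsilon> j)\<bar> = 1" using sign by linarith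
    then show "\<bar>real_of_int (f z - g z)\<bar> = (if z = int j then 2 * real n else 0)"
      using same[of z] j by (auto simp: f_def g_def cube_embedding_def abs_mult simp flip: mult_2)
  qed
  also have "\<dots> = 2 * real n" by simp
  finally show ?thesis using j by (simp add: eq)
qed

lemma not_enflo_type_wreath_ZZ:
  assumes p: "p > 1"
  shows "\<not> enflo_type (carrier wreath_ZZ) wreath_ZZ_dist p"
proof
  assume "enflo_type (carrier wreath_ZZ) wreath_ZZ_dist p"
  then obtain K where K: "K > 0" and enflo: "\<forall>n. \<forall>f \<in> sign_cube n \<rightarrow> carrier wreath_ZZ.
      measure_pmf.expectation (pmf_of_set (sign_cube n))
        (\<lambda>\<epsilon>. wreath_ZZ_dist (f \<epsilon>) (f (cube_neg n \<epsilon>)) powr p)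
      \<le> K powr p * (\<Sum>j=1..n. measure_pmf.expectation (pmf_of_set (sign_cube n))
          (\<lambda>\<epsilon>. wreath_ZZ_dist (f \<epsilon>) (f (\<epsilon>(j := - \<epsilon> j))) powr p))"
    unfolding enflo_type_def by (elim exE conjE)
  have nonneg: "0 \<le> wreath_ZZ_dist u v" for u v
    by (simp add: wreath_ZZ_dist_def path_dist_def)
  have bound: "real n powr (p - 1) \<le> (4 * K) powr p" if n: "n > 0" for n
  proof -
    let ?f = "cube_embedding n"
    have "(2 * real n ^ 2) powr p \<le> measure_pmf.expectation (pmf_of_set (sign_cube n))
        (\<lambda>\<epsilon>. wreath_ZZ_dist (?f \<epsilon>) (?f (cube_neg n \<epsilon>)) powr p)"
      using p by (intro expectation_sign_cube_ge powr_mono2 cube_embedding_antipode) auto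
    also have "\<dots> \<le> K powr p * (\<Sum>j=1..n. measure_pmf.expectation (pmf_of_set (sign_cube n))
          (\<lambda>\<epsilon>. wreath_ZZ_dist (?f \<epsilon>) (?f (\<epsilon>(j := - \<epsilon> j))) powr p))"
      by (rule bspec[OF spec[OF enflo]]) (simp add: cube_embedding_carrier)
    also have "\<dots> \<le> K powr p * (\<Sum>j=1..n. (8 * real n) powr p)"
      using p nonneg
      by (intro mult_left_mono sum_mono expectation_sign_cube_le powr_mono2 cube_embedding_flip) auto
    also have "\<dots> = (K * (8 * real n)) powr p * real n"
      using K by (simp add: powr_mult)
    also have "K * (8 * real n) = (4 * K) * (2 * real n)" by simp
    also have "\<dots> powr p = (4 * K) powr p * (2 * real n) powr p"
      using K by (subst powr_mult) auto
    finally have "(2 * real n) powr p * real n powr p \<le> (4 * K) powr p * (2 * real n) powr p * real n"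
      by (simp add: power2_eq_square powr_mult mult.assoc)
    then have "(2 * real n) powr p * real n powr p \<le> (2 * real n) powr p * ((4 * K) powr p * real n)"
      by (simp only: mult_ac)
    then have "real n powr p \<le> (4 * K) powr p * real n"
      using n by (subst (asm) mult_le_cancel_left_pos) auto
    then show ?thesis
      using n by (simp add: powr_diff divide_le_eq)
  qed
  have "filterlim (\<lambda>n. real n powr (p - 1)) at_top sequentially"
    using p by real_asymp
  then have "eventually (\<lambda>n. real n powr (p - 1) > (4 * K) powr p) sequentially"
    by (simp add: filterlim_at_top_dense)
  then have "eventually (\<lambda>n. real n powr (p - 1) > (4 * K) powr p \<and> n > 0) sequentially"
    by (intro eventually_conj eventually_gt_at_top)
  then obtain n :: nat where "real n powr (p - 1) > (4 * K) powr p" "n > 0"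
    by (auto simp: eventually_sequentially)
  then show False using bound[of n] by simp
qed

section \<open>Edge Markov type without Enflo type\<close>

theorem mainTheorem10:
  shows "(\<forall>p::real. 1 \<le> p \<and> p < 4 / 3 \<longrightarrow>
            edge_markov_type (carrier wreath_ZZ) wreath_ZZ_adj p)
       \<and> (\<forall>p::real. p > 1 \<longrightarrow> \<not> enflo_type (carrier wreath_ZZ) wreath_ZZ_dist p)"
  using edge_markov_type_wreath_ZZ not_enflo_type_wreath_ZZ by blast

end
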